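(* Let $M\times_\lambda N$ be the singly warped product of Riemannian manifolds $(M,g)$ and $(N,h)$ with smooth warping function $\lambda:M\to(0,+\infty)$; let $x_0\in M$ and let $f:N\to(0,+\infty)$ be a smooth function. Then the inclusion map $i_{x_0}:(N,h)\to M\times_\lambda N$, $i_{x_0}(y)=(x_0,y)$, is not a non-trivial $f$-bi-harmonic map.
   Context: $M\times_\lambda N$ is $M\times N$ with the metric $\bar g=g\oplus\lambda^2h$. Curvature convention: $R(X,Y)Z=\nabla_X\nabla_YZ-\nabla_Y\nabla_XZ-\nabla_{[X,Y]}Z$. For a smooth map $\phi:(N,h)\to(P,k)$ and a positive smooth function $f$ on $N$, $\tau(\phi)=\mathrm{Tr}_h\nabla d\phi$ ($\phi$ is harmonic iff $\tau(\phi)=0$); $\phi$ is $f$-bi-harmonic if it is a critical point of $E_{2,f}(\phi)=\frac12\int_\Omega f|\tau(\phi)|^2dv_h$ for every compact domain $\Omega\subset N$; equivalently $\tau_{2,f}(\phi)=-\mathrm{Tr}_h(\nabla^\phi)^2(f\tau(\phi))-f\sum_\alpha R^P(\tau(\phi),d\phi(\bar e_\alpha))d\phi(\bar e_\alpha)=0$, where $\nabla^\phi$ is the pull-back connection, $\{\bar e_\alpha\}$ a local orthonormal frame of $N$, and $\mathrm{Tr}_h(\nabla^\phi)^2V=\sum_\alpha(\nabla^\phi_{\bar e_\alpha}\nabla^\phi_{\bar e_\alpha}V-\nabla^\phi_{\nabla_{\bar e_\alpha}\bar e_\alpha}V)$. An $f$-bi-harmonic map is called non-trivial if $f$ is non-constant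 and the map is not harmonic.
   Formalization: N is assumed connected; otherwise the claim fails, e.g. M=(0,π), λ=sin, x₀=π/4, N two disjoint copies of Sⁿ and f constant on each copy with different values. M and N have dimension at least 1. *)

theory Defs
  imports "HOL-Analysis.Analysis"
begin

section \<open>Smooth manifolds\<close>

text \<open>\<open>Ck_on k S F\<close> is only meant for open \<open>S\<close>, where \<open>frechet_derivative F (at x) v\<close> is the
  directional derivative of \<open>F\<close> and does not depend on the values of \<open>F\<close> outside \<open>S\<close>.\<close>

fun Ck_on :: "nat \<Rightarrow> 'a::euclidean_space set \<Rightarrow> ('a \<Rightarrow> 'b::real_normed_vector) \<Rightarrow> bool" where
  "Ck_on 0 S F \<longleftrightarrow> continuous_on S F"
| "Ck_on (Suc k) S F \<longleftrightarrow>
     F differentiable_on S \<and> (\<forall>v. Ck_on k S (\<lambda>x. frechet_derivative F (at x) v))"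

definition smooth_on :: "'a::euclidean_space set \<Rightarrow> ('a \<Rightarrow> 'b::real_normed_vector) \<Rightarrow> bool" where
  "smooth_on S F \<longleftrightarrow> (\<forall>k. Ck_on k S F)"

text \<open>A chart is a pair of its domain and its coordinate map; the values of the coordinate map
  outside the domain are irrelevant.\<close>

type_synonym ('m, 'e) chart = "'m set \<times> ('m \<Rightarrow> 'e)"

definition chart_image :: "('m, 'e) chart \<Rightarrow> 'e set" where
  "chart_image c = snd c ` fst c"

definition chart_inv :: "('m, 'e) chart \<Rightarrow> 'e \<Rightarrow> 'm" where
  "chart_inv c = inv_into (fst c) (snd c)"

text \<open>The points of a manifold are all the elements of a Hausdorff, second countable type, its
  smooth structure is the one determined by an atlas, here an indexed family of charts.\<close>

definition smooth_atlas ::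
    "('i \<Rightarrow> ('m::{t2_space,second_countable_topology}, 'e::euclidean_space) chart) \<Rightarrow> bool" where
  "smooth_atlas A \<longleftrightarrow>
     (\<Union>i. fst (A i)) = UNIV \<and>
     (\<forall>i. open (fst (A i)) \<and> open (chart_image (A i)) \<and>
          homeomorphism (fst (A i)) (chart_image (A i)) (snd (A i)) (chart_inv (A i))) \<and>
     (\<forall>i j. smooth_on (snd (A i) ` (fst (A i) \<inter> fst (A j))) (snd (A j) \<circ> chart_inv (A i)))"

definition smooth_fun :: "('i \<Rightarrow> ('m, 'e::euclidean_space) chart) \<Rightarrow> ('m \<Rightarrow> real) \<Rightarrow> bool" where
  "smooth_fun A f \<longleftrightarrow> (\<forall>i. smooth_on (chart_image (A i)) (f \<circ> chart_inv (A i)))"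

definition local_rep ::
    "('m, 'e) chart \<Rightarrow> ('p, 'd) chart \<Rightarrow> ('m \<Rightarrow> 'p) \<Rightarrow> 'e \<Rightarrow> 'd" where
  "local_rep c d \<phi> = snd d \<circ> \<phi> \<circ> chart_inv c"

definition local_dom ::
    "('m, 'e) chart \<Rightarrow> ('p, 'd) chart \<Rightarrow> ('m \<Rightarrow> 'p) \<Rightarrow> 'e set" where
  "local_dom c d \<phi> = snd c ` (fst c \<inter> \<phi> -` fst d)"

definition smooth_map ::
    "('i \<Rightarrow> ('m::topological_space, 'e::euclidean_space) chart) \<Rightarrow>
     ('j \<Rightarrow> ('p::topological_space, 'd::euclidean_space) chart) \<Rightarrow> ('m \<Rightarrow> 'p) \<Rightarrow> bool" where
  "smooth_map A B \<phi> \<longleftrightarrow>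
     continuous_on UNIV \<phi> \<and>
     (\<forall>i j. smooth_on (local_dom (A i) (B j) \<phi>) (local_rep (A i) (B j) \<phi>))"

section \<open>Riemannian metrics and warped products\<close>

text \<open>A metric is given by its components: \<open>g i x u v\<close> is the value of the metric at the point with
  coordinates \<open>x\<close> in the \<open>i\<close>-th chart, on the tangent vectors with components \<open>u\<close> and \<open>v\<close> in that
  chart. The last clause is the transformation law of a covariant 2-tensor.\<close>

type_synonym 'e local_metric = "'e \<Rightarrow> 'e \<Rightarrow> 'e \<Rightarrow> real"

definition riemannian_metric ::
    "('i \<Rightarrow> ('m, 'e::euclidean_space) chart) \<Rightarrow> ('i \<Rightarrow> 'e local_metric) \<Rightarrow> bool" where
  "riemannian_metric A g \<longleftrightarrow>
     (\<forall>i. \<forall>x\<in>chart_image (A i).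
        bilinear (g i x) \<and> (\<forall>u v. g i x u v = g i x v u) \<and> (\<forall>u. u \<noteq> 0 \<longrightarrow> 0 < g i x u u)) \<and>
     (\<forall>i u v. smooth_on (chart_image (A i)) (\<lambda>x. g i x u v)) \<and>
     (\<forall>i j. \<forall>p\<in>fst (A i) \<inter> fst (A j). \<forall>u v.
        g i (snd (A i) p) u v =
        (let T = frechet_derivative (snd (A j) \<circ> chart_inv (A i)) (at (snd (A i) p))
         in g j (snd (A j) p) (T u) (T v)))"

definition prod_atlas ::
    "('i \<Rightarrow> ('m, 'e) chart) \<Rightarrow> ('j \<Rightarrow> ('n, 'd) chart) \<Rightarrow> 'i \<times> 'j \<Rightarrow> ('m \<times> 'n, 'e \<times> 'd) chart" where
  "prod_atlas A B = (\<lambda>(i, j). (fst (A i) \<times> fst (B j), map_prod (snd (A i)) (snd (B j))))"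

definition warped_metric ::
    "('i \<Rightarrow> ('m, 'e) chart) \<Rightarrow> ('i \<Rightarrow> 'e local_metric) \<Rightarrow> ('m \<Rightarrow> real) \<Rightarrow> ('j \<Rightarrow> 'd local_metric) \<Rightarrow>
     'i \<times> 'j \<Rightarrow> ('e \<times> 'd) local_metric" where
  "warped_metric A g lam h =
     (\<lambda>(i, j) (x, y) (u, u') (v, v').
        g i x u v + (lam (chart_inv (A i) x))\<^sup>2 * h j y u' v')"

section \<open>Riemannian geometry in a chart\<close>

text \<open>The Levi-Civita connection in a chart, \<open>\<nabla>\<^sub>u v\<close> for constant coordinate fields, given by the
  Koszul formula (the bracket terms vanish).\<close>

definition christoffel :: "'e::euclidean_space local_metric \<Rightarrow> 'e \<Rightarrow> 'e \<Rightarrow> 'e \<Rightarrow> 'e" where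
  "christoffel G x u v =
     (THE z. \<forall>w. 2 * G x z w =
        frechet_derivative (\<lambda>y. G y v w) (at x) u
      + frechet_derivative (\<lambda>y. G y u w) (at x) v
      - frechet_derivative (\<lambda>y. G y u v) (at x) w)"

definition nabla ::
    "'e::euclidean_space local_metric \<Rightarrow> ('e \<Rightarrow> 'e) \<Rightarrow> ('e \<Rightarrow> 'e) \<Rightarrow> 'e \<Rightarrow> 'e" where
  "nabla G X Y = (\<lambda>x. frechet_derivative Y (at x) (X x) + christoffel G x (X x) (Y x))"

text \<open>\<open>R(u,v)w = \<nabla>\<^sub>u\<nabla>\<^sub>v w - \<nabla>\<^sub>v\<nabla>\<^sub>u w - \<nabla>\<^bsub>[u,v]\<^esub> w\<close>, where \<open>u, v, w\<close> are extended to constant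
  coordinate fields, so that \<open>[u,v] = 0\<close>.\<close>

definition curvature :: "'e::euclidean_space local_metric \<Rightarrow> 'e \<Rightarrow> 'e \<Rightarrow> 'e \<Rightarrow> 'e \<Rightarrow> 'e" where
  "curvature G x u v w =
     nabla G (\<lambda>_. u) (nabla G (\<lambda>_. v) (\<lambda>_. w)) x
   - nabla G (\<lambda>_. v) (nabla G (\<lambda>_. u) (\<lambda>_. w)) x"

definition orthonormal_basis :: "('e::euclidean_space \<Rightarrow> 'e \<Rightarrow> real) \<Rightarrow> 'e set \<Rightarrow> bool" where
  "orthonormal_basis b E \<longleftrightarrow>
     finite E \<and> card E = DIM('e) \<and> (\<forall>u\<in>E. \<forall>v\<in>E. b u v = (if u = v then 1 else 0))"

text \<open>The trace of a bilinear map \<open>T\<close> with respect to an inner product \<open>b\<close>; it does not depend on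
  the orthonormal basis.\<close>

definition metric_trace ::
    "('e::euclidean_space \<Rightarrow> 'e \<Rightarrow> real) \<Rightarrow> ('e \<Rightarrow> 'e \<Rightarrow> 'd::real_vector) \<Rightarrow> 'd" where
  "metric_trace b T = (\<Sum>e\<in>(SOME E. orthonormal_basis b E). T e e)"

text \<open>In the following, \<open>G\<close> and \<open>K\<close> are the metrics of the source and the target in fixed charts,
  \<open>F\<close> is the map in these charts, and a vector field \<open>V\<close> along the map is given by its components.\<close>

definition pullback_nabla ::
    "'d::euclidean_space local_metric \<Rightarrow> ('e::euclidean_space \<Rightarrow> 'd) \<Rightarrow>
     ('e \<Rightarrow> 'e) \<Rightarrow> ('e \<Rightarrow> 'd) \<Rightarrow> 'e \<Rightarrow> 'd" where
  "pullback_nabla K F X V =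
     (\<lambda>x. frechet_derivative V (at x) (X x)
        + christoffel K (F x) (frechet_derivative F (at x) (X x)) (V x))"

text \<open>\<open>(\<nabla>d\<phi>)(u,v) = \<nabla>\<^sup>\<phi>\<^sub>u (d\<phi>(v)) - d\<phi>(\<nabla>\<^sub>u v)\<close>\<close>

definition second_fundamental_form ::
    "'e::euclidean_space local_metric \<Rightarrow> 'd::euclidean_space local_metric \<Rightarrow> ('e \<Rightarrow> 'd) \<Rightarrow>
     'e \<Rightarrow> 'e \<Rightarrow> 'e \<Rightarrow> 'd" where
  "second_fundamental_form G K F x u v =
     pullback_nabla K F (\<lambda>_. u) (\<lambda>y. frechet_derivative F (at y) v) x
   - frechet_derivative F (at x) (nabla G (\<lambda>_. u) (\<lambda>_. v) x)"

definition tension ::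
    "'e::euclidean_space local_metric \<Rightarrow> 'd::euclidean_space local_metric \<Rightarrow> ('e \<Rightarrow> 'd) \<Rightarrow>
     'e \<Rightarrow> 'd" where
  "tension G K F x = metric_trace (G x) (second_fundamental_form G K F x)"

text \<open>The expression \<open>\<nabla>\<^sup>\<phi>\<^sub>X\<nabla>\<^sup>\<phi>\<^sub>Y V - \<nabla>\<^sup>\<phi>\<^bsub>\<nabla>\<^sub>X Y\<^esub> V\<close> is tensorial in \<open>X\<close> and \<open>Y\<close>. Hence an orthonormal
  basis at \<open>x\<close>, extended to constant coordinate fields, gives the same trace as a local orthonormal
  frame.\<close>

definition trace_nabla2 ::
    "'e::euclidean_space local_metric \<Rightarrow> 'd::euclidean_space local_metric \<Rightarrow> ('e \<Rightarrow> 'd) \<Rightarrow>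
     ('e \<Rightarrow> 'd) \<Rightarrow> 'e \<Rightarrow> 'd" where
  "trace_nabla2 G K F V x =
     metric_trace (G x) (\<lambda>u v.
       pullback_nabla K F (\<lambda>_. u) (pullback_nabla K F (\<lambda>_. v) V) x
     - pullback_nabla K F (nabla G (\<lambda>_. u) (\<lambda>_. v)) V x)"

definition f_bitension ::
    "('e::euclidean_space \<Rightarrow> real) \<Rightarrow> 'e local_metric \<Rightarrow> 'd::euclidean_space local_metric \<Rightarrow>
     ('e \<Rightarrow> 'd) \<Rightarrow> 'e \<Rightarrow> 'd" where
  "f_bitension f G K F x =
     - trace_nabla2 G K F (\<lambda>y. f y *\<^sub>R tension G K F y) x
     - f x *\<^sub>R metric_trace (G x) (\<lambda>u v.
         curvature K (F x) (tension G K F x)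
           (frechet_derivative F (at x) u) (frechet_derivative F (at x) v))"

section \<open>Harmonic and f-bi-harmonic maps\<close>

definition harmonic_map ::
    "('i \<Rightarrow> ('n::topological_space, 'e::euclidean_space) chart) \<Rightarrow> ('i \<Rightarrow> 'e local_metric) \<Rightarrow>
     ('j \<Rightarrow> ('p::topological_space, 'd::euclidean_space) chart) \<Rightarrow> ('j \<Rightarrow> 'd local_metric) \<Rightarrow>
     ('n \<Rightarrow> 'p) \<Rightarrow> bool" where
  "harmonic_map A h B k \<phi> \<longleftrightarrow>
     smooth_map A B \<phi> \<and>
     (\<forall>i j. \<forall>x\<in>local_dom (A i) (B j) \<phi>.
        tension (h i) (k j) (local_rep (A i) (B j) \<phi>) x = 0)"

text \<open>\<open>f\<close>-bi-harmonicity is expressed by the Euler-Lagrange equation \<open>\<tau>\<^sub>2\<^sub>,\<^sub>f(\<phi>) = 0\<close> of the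
  functional \<open>E\<^sub>2\<^sub>,\<^sub>f(\<phi>) = 1/2 \<integral> f |\<tau>(\<phi>)|\<^sup>2\<close> on compact domains.\<close>

definition f_biharmonic_map ::
    "('n \<Rightarrow> real) \<Rightarrow>
     ('i \<Rightarrow> ('n::topological_space, 'e::euclidean_space) chart) \<Rightarrow> ('i \<Rightarrow> 'e local_metric) \<Rightarrow>
     ('j \<Rightarrow> ('p::topological_space, 'd::euclidean_space) chart) \<Rightarrow> ('j \<Rightarrow> 'd local_metric) \<Rightarrow>
     ('n \<Rightarrow> 'p) \<Rightarrow> bool" where
  "f_biharmonic_map f A h B k \<phi> \<longleftrightarrow>
     smooth_map A B \<phi> \<and>
     (\<forall>i j. \<forall>x\<in>local_dom (A i) (B j) \<phi>.
        f_bitension (f \<circ> chart_inv (A i)) (h i) (k j) (local_rep (A i) (B j) \<phi>) x = 0)"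

definition nontrivial_f_biharmonic_map ::
    "('n \<Rightarrow> real) \<Rightarrow>
     ('i \<Rightarrow> ('n::topological_space, 'e::euclidean_space) chart) \<Rightarrow> ('i \<Rightarrow> 'e local_metric) \<Rightarrow>
     ('j \<Rightarrow> ('p::topological_space, 'd::euclidean_space) chart) \<Rightarrow> ('j \<Rightarrow> 'd local_metric) \<Rightarrow>
     ('n \<Rightarrow> 'p) \<Rightarrow> bool" where
  "nontrivial_f_biharmonic_map f A h B k \<phi> \<longleftrightarrow>
     f_biharmonic_map f A h B k \<phi> \<and> \<not> f constant_on UNIV \<and> \<not> harmonic_map A h B k \<phi>"

end

theory Submission
  imports Defs
begin

text \<open>Put \<open>L = \<lambda>\<^sup>2\<close>, \<open>n = dim N\<close> and let \<open>Z\<close> be the gradient of \<open>L\<close> at \<open>x\<^sub>0\<close>. The Christoffel symbols of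
  \<open>g \<oplus> L h\<close> in product charts show that the second fundamental form of the inclusion is
  \<open>(- h/2 \<cdot> Z, 0)\<close>, so its tension field is the constant field \<open>(T, 0)\<close> with \<open>T = - n/2 \<cdot> Z\<close>. The
  \<open>N\<close>-component of the \<open>f\<close>-bitension field then reduces to \<open>- 2c \<cdot> grad f\<close> with
  \<open>c = dL(T) / (2L) = - n/(4L) \<cdot> |Z|\<^sup>2\<close>. If \<open>f\<close> is not constant, its differential is non-zero at
  some point, so that \<open>c = 0\<close>, hence \<open>Z = 0\<close> and the inclusion is harmonic.\<close>

section \<open>Derivatives\<close>

text \<open>The factor 2 in \<open>2c\<close> has two sources. The first derivative of
  \<open>f T\<close> along a vertical \<open>v\<close> has the horizontal part
  \<open>df(v) T\<close> and, through the mixed Christoffel symbols, the vertical part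
  \<open>f c v\<close>. Deriving again along \<open>u\<close> turns the former into
  \<open>c df(v) u\<close> and the latter into \<open>c df(u) v\<close>. The curvature term has no
  N-component, because \<open>R(T, e) e\<close> is horizontal for horizontal \<open>T\<close> and
  vertical \<open>e\<close>. Two features shape the rest. \<open>christoffel\<close> and
  \<open>metric_trace\<close> are given by description and choice, so the connection must first be
  shown to exist and to be differentiable; a differentiable orthonormal frame supplies bases for the
  traces and explicit formulas for dual vectors. Moreover, harmonicity concerns every pair of
  charts, also when the source chart of N differs from the N-factor of the product chart. The second
  component of the inclusion is then a transition map, and it contributes nothing because the
  Levi-Civita connection is invariant under isometries, which rests on the symmetry of second
  derivatives.\<close>

abbreviation D :: "('a::real_normed_vector \<Rightarrow> 'b::real_normed_vector) \<Rightarrow> 'a \<Rightarrow> 'a \<Rightarrow> 'b" where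
  "D F x \<equiv> frechet_derivative F (at x)"

lemma D_eq: "(F has_derivative F') (at x) \<Longrightarrow> D F x = F'"
  by (metis frechet_derivative_at)

lemma differentiable_on_has_derivative:
  "open S \<Longrightarrow> F differentiable_on S \<Longrightarrow> x \<in> S \<Longrightarrow> (F has_derivative D F x) (at x)"
  by (simp add: differentiable_on_eq_differentiable_at frechet_derivative_works)

lemma differentiable_on_transform:
  assumes "F differentiable_on S" "\<And>x. x \<in> S \<Longrightarrow> F' x = F x"
  shows "F' differentiable_on S"
  using assms unfolding differentiable_on_def
  by (metis (no_types, lifting) differentiable_transform_within zero_less_one)

lemma differentiable_on_sum:
  "finite I \<Longrightarrow> (\<And>i. i \<in> I \<Longrightarrow> F i differentiable_on S) \<Longrightarrow> (\<lambda>x. \<Sum>i\<in>I. F i x) differentiable_on S"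
  by (simp add: differentiable_on_def differentiable_sum)

text \<open>No differentiability is assumed: \<open>frechet_derivative\<close> is a choice from the
  predicate \<open>has_derivative\<close>, and equal predicates yield equal choices.\<close>

lemma D_cong_open:
  assumes "open S" "x \<in> S" "\<And>y. y \<in> S \<Longrightarrow> F y = F' y"
  shows "D F x = D F' x"
proof -
  have "(F has_derivative F1) (at x) \<longleftrightarrow> (F' has_derivative F1) (at x)" for F1
    using assms has_derivative_transform_within_open[of F F1 x UNIV S F']
      has_derivative_transform_within_open[of F' F1 x UNIV S F] by auto
  then show ?thesis
    by (simp add: frechet_derivative_def)
qed

lemma smooth_on_differentiable: "smooth_on S F \<Longrightarrow> F differentiable_on S"
  unfolding smooth_on_def using Ck_on.simps(2) by blast

lemma smooth_on_D: "smooth_on S F \<Longrightarrow> smooth_on S (\<lambda>x. D F x v)"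
  unfolding smooth_on_def using Ck_on.simps(2) by blast

lemma smooth_on_continuous: "smooth_on S F \<Longrightarrow> continuous_on S F"
  using smooth_on_differentiable differentiable_imp_continuous_on by blast

section \<open>Symmetry of second derivatives\<close>

lemma has_derivative_along_line:
  fixes f :: "'a::real_normed_vector \<Rightarrow> real"
  assumes "(f has_derivative f') (at (x + s *\<^sub>R u))"
  shows "((\<lambda>t. f (x + t *\<^sub>R u)) has_real_derivative f' u) (at s)"
proof -
  have "((\<lambda>t. x + t *\<^sub>R u) has_derivative (\<lambda>t. t *\<^sub>R u)) (at s)"
    by (auto intro!: derivative_eq_intros)
  from diff_chain_at[OF this assms]
  have "((\<lambda>t. f (x + t *\<^sub>R u)) has_derivative (\<lambda>t. f' (t *\<^sub>R u))) (at s)"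
    by (simp add: o_def)
  moreover have "f' (t *\<^sub>R u) = f' u * t" for t
    using has_derivative_linear[OF assms] by (simp add: linear_cmul)
  ultimately show ?thesis
    by (simp add: has_field_derivative_def)
qed

text \<open>Two mean value theorems: the second difference is an increment in direction
  \<open>u\<close> of the function \<open>p\<close>, and the resulting expression is an increment in
  direction \<open>v\<close> of the function \<open>q\<close>.\<close>

lemma second_difference_mean_value:
  fixes f :: "'a::real_normed_vector \<Rightarrow> real"
  assumes "0 < s"
    and P: "\<And>a b. 0 \<le> a \<Longrightarrow> a \<le> s \<Longrightarrow> 0 \<le> b \<Longrightarrow> b \<le> s \<Longrightarrow> x + a *\<^sub>R u + b *\<^sub>R v \<in> S"
    and f': "\<And>y. y \<in> S \<Longrightarrow> (f has_derivative f' y) (at y)"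
    and f'': "\<And>y. y \<in> S \<Longrightarrow> ((\<lambda>z. f' z u) has_derivative f'' y) (at y)"
  shows "\<exists>a b. 0 < a \<and> a < s \<and> 0 < b \<and> b < s \<and>
    f (x + s *\<^sub>R u + s *\<^sub>R v) - f (x + s *\<^sub>R u) - f (x + s *\<^sub>R v) + f x
      = s * s * f'' (x + a *\<^sub>R u + b *\<^sub>R v) v"
proof -
  define p where "p t = f (x + s *\<^sub>R v + t *\<^sub>R u) - f (x + t *\<^sub>R u)" for t
  have "(p has_real_derivative (f' (x + s *\<^sub>R v + t *\<^sub>R u) u - f' (x + t *\<^sub>R u) u)) (at t)"
    if "0 \<le> t" "t \<le> s" for t
  proof -
    have "x + s *\<^sub>R v + t *\<^sub>R u \<in> S" "x + t *\<^sub>R u \<in> S"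
      using P[of t s] P[of t 0] that by (simp_all add: algebra_simps)
    then show ?thesis
      unfolding p_def by (intro DERIV_diff has_derivative_along_line f')
  qed
  from MVT2[OF \<open>0 < s\<close> this] obtain a where a: "0 < a" "a < s"
    and pa: "p s - p 0 = s * (f' (x + s *\<^sub>R v + a *\<^sub>R u) u - f' (x + a *\<^sub>R u) u)"
    by auto
  define q where "q t = f' (x + a *\<^sub>R u + t *\<^sub>R v) u" for t
  have "(q has_real_derivative f'' (x + a *\<^sub>R u + t *\<^sub>R v) v) (at t)" if "0 \<le> t" "t \<le> s" for t
    unfolding q_def using has_derivative_along_line[of "\<lambda>z. f' z u" _ "x + a *\<^sub>R u" t v] f'' P a that
    by simp
  from MVT2[OF \<open>0 < s\<close> this] obtain b where b: "0 < b" "b < s"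
    and qb: "q s - q 0 = s * f'' (x + a *\<^sub>R u + b *\<^sub>R v) v"
    by auto
  have "p s - p 0 = s * (q s - q 0)"
    using pa by (simp add: q_def algebra_simps)
  then show ?thesis
    using a b qb by (intro exI[of _ a] exI[of _ b]) (simp add: p_def algebra_simps)
qed

text \<open>The second difference over a parallelogram is symmetric in \<open>u\<close> and
  \<open>v\<close>, so it equals \<open>s * s\<close> times a value of either mixed derivative near
  \<open>x\<close>. By continuity both values are within half the supposed gap of their values at
  \<open>x\<close>, hence cannot coincide.\<close>

lemma symmetric_second_derivative_real:
  fixes f :: "'a::real_normed_vector \<Rightarrow> real"
  assumes "open S" "x \<in> S"
    and f': "\<And>y. y \<in> S \<Longrightarrow> (f has_derivative f' y) (at y)"
    and U: "\<And>y. y \<in> S \<Longrightarrow> ((\<lambda>z. f' z u) has_derivative U y) (at y)"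
    and V: "\<And>y. y \<in> S \<Longrightarrow> ((\<lambda>z. f' z v) has_derivative V y) (at y)"
    and cU: "continuous_on S (\<lambda>y. U y v)" and cV: "continuous_on S (\<lambda>y. V y u)"
  shows "U x v = V x u"
proof (rule ccontr)
  assume ne: "U x v \<noteq> V x u"
  define e where "e = \<bar>U x v - V x u\<bar> / 2"
  have e: "e > 0" using ne by (simp add: e_def)
  have "isCont (\<lambda>y. U y v) x" "isCont (\<lambda>y. V y u) x"
    using assms by (simp_all add: continuous_on_eq_continuous_at)
  then have "((\<lambda>y. U y v) \<longlongrightarrow> U x v) (nhds x)" "((\<lambda>y. V y u) \<longlongrightarrow> V x u) (nhds x)"
    unfolding isCont_def using tendsto_at_iff_tendsto_nhds[of "\<lambda>y. U y v" x]
      tendsto_at_iff_tendsto_nhds[of "\<lambda>y. V y u" x] by blast+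
  then have "\<forall>\<^sub>F y in nhds x. dist (U y v) (U x v) < e \<and> dist (V y u) (V x u) < e"
    using e by (auto intro!: eventually_conj tendstoD)
  moreover have "\<forall>\<^sub>F y in nhds x. y \<in> S"
    using assms eventually_nhds by blast
  ultimately have "\<forall>\<^sub>F y in nhds x. y \<in> S \<and> dist (U y v) (U x v) < e \<and> dist (V y u) (V x u) < e"
    by eventually_elim auto
  then obtain d where d: "d > 0"
    and near: "\<And>y. dist y x < d \<Longrightarrow> y \<in> S \<and> dist (U y v) (U x v) < e \<and> dist (V y u) (V x u) < e"
    unfolding eventually_nhds_metric by auto
  \<comment> \<open>The summand 1 keeps \<open>N\<close> positive even for \<open>u = v = 0\<close>;
    the parallelogram with sides \<open>s *\<^sub>R u\<close> and \<open>s *\<^sub>R v\<close> then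
    stays within distance \<open>d\<close> of \<open>x\<close>.\<close>
  define N where "N = norm u + norm v + 1"
  have N: "N > 0" by (simp add: N_def add_nonneg_pos)
  define s where "s = d / (2 * N)"
  have s: "s > 0" using d N by (simp add: s_def)
  have close: "dist (x + a *\<^sub>R u + b *\<^sub>R v) x < d" if "0 \<le> a" "a \<le> s" "0 \<le> b" "b \<le> s" for a b
  proof -
    have "dist (x + a *\<^sub>R u + b *\<^sub>R v) x \<le> a * norm u + b * norm v"
      using norm_triangle_ineq[of "a *\<^sub>R u" "b *\<^sub>R v"] that by (simp add: dist_norm)
    also have "\<dots> \<le> s * norm u + s * norm v"
      using that by (intro add_mono mult_right_mono) auto
    also have "\<dots> = (N - 1) * s"
      by (simp add: N_def algebra_simps)
    also have "\<dots> < 2 * N * s"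
      using s N by (intro mult_strict_right_mono) auto
    also have "\<dots> = d"
      using N by (simp add: s_def)
    finally show ?thesis .
  qed
  obtain a b where ab: "0 < a" "a < s" "0 < b" "b < s"
    "f (x + s *\<^sub>R u + s *\<^sub>R v) - f (x + s *\<^sub>R u) - f (x + s *\<^sub>R v) + f x
      = s * s * U (x + a *\<^sub>R u + b *\<^sub>R v) v"
    using second_difference_mean_value[OF s _ f' U, of x v] near close by blast
  have "x + a *\<^sub>R v + b *\<^sub>R u \<in> S" if "0 \<le> a" "a \<le> s" "0 \<le> b" "b \<le> s" for a b
    using near close[of b a] that by (simp add: algebra_simps)
  then obtain a' b' where ab': "0 < a'" "a' < s" "0 < b'" "b' < s"
    "f (x + s *\<^sub>R v + s *\<^sub>R u) - f (x + s *\<^sub>R v) - f (x + s *\<^sub>R u) + f x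
      = s * s * V (x + a' *\<^sub>R v + b' *\<^sub>R u) u"
    using second_difference_mean_value[OF s _ f' V, of x u] by blast
  have "s * s * U (x + a *\<^sub>R u + b *\<^sub>R v) v = s * s * V (x + b' *\<^sub>R u + a' *\<^sub>R v) u"
    using ab(5) ab'(5) by (simp add: algebra_simps)
  then have "U (x + a *\<^sub>R u + b *\<^sub>R v) v = V (x + b' *\<^sub>R u + a' *\<^sub>R v) u"
    using s by simp
  moreover have "dist (U (x + a *\<^sub>R u + b *\<^sub>R v) v) (U x v) < e"
    using near close ab by simp
  moreover have "dist (V (x + b' *\<^sub>R u + a' *\<^sub>R v) u) (V x u) < e"
    using near close ab' by simp
  ultimately show False
    unfolding e_def dist_real_def by (simp add: field_simps abs_if split: if_splits)
qed

lemma symmetric_second_derivative: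
  fixes F :: "'a::euclidean_space \<Rightarrow> 'b::euclidean_space"
  assumes "open S" "x \<in> S" and F: "smooth_on S F"
  shows "D (\<lambda>y. D F y u) x v = D (\<lambda>y. D F y v) x u"
proof (rule euclidean_eqI)
  fix b :: 'b assume "b \<in> Basis"
  have F2: "smooth_on S (\<lambda>y. D F y w)" "smooth_on S (\<lambda>y. D (\<lambda>y. D F y w) y w')" for w w'
    by (intro smooth_on_D F)+
  have "((\<lambda>z. F z \<bullet> b) has_derivative (\<lambda>t. D F y t \<bullet> b)) (at y)" if "y \<in> S" for y
    using that assms by (intro has_derivative_inner_left differentiable_on_has_derivative[of S]
      smooth_on_differentiable)
  moreover have "((\<lambda>z. D F z w \<bullet> b) has_derivative (\<lambda>t. D (\<lambda>z. D F z w) y t \<bullet> b)) (at y)"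
    if "y \<in> S" for y w
    using that assms by (intro has_derivative_inner_left differentiable_on_has_derivative[of S]
      smooth_on_differentiable F2)
  moreover have "continuous_on S (\<lambda>y. D (\<lambda>z. D F z w) y w' \<bullet> b)" for w w'
    by (intro continuous_intros smooth_on_continuous F2)
  ultimately show "D (\<lambda>y. D F y u) x v \<bullet> b = D (\<lambda>y. D F y v) x u \<bullet> b"
    using symmetric_second_derivative_real[OF assms(1,2), of "\<lambda>z. F z \<bullet> b" "\<lambda>y t. D F y t \<bullet> b" u
       "\<lambda>y t. D (\<lambda>z. D F z u) y t \<bullet> b" v "\<lambda>y t. D (\<lambda>z. D F z v) y t \<bullet> b"] by blast
qed

section \<open>Fields of inner products\<close>

lemma bilinear_expansion:
  fixes b :: "'a::euclidean_space \<Rightarrow> 'c::euclidean_space \<Rightarrow> real"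
  assumes "bilinear b"
  shows "b u v = (\<Sum>i\<in>Basis. \<Sum>j\<in>Basis. (u \<bullet> i) * (v \<bullet> j) * b i j)"
proof -
  have "b u v = b (\<Sum>i\<in>Basis. (u \<bullet> i) *\<^sub>R i) (\<Sum>j\<in>Basis. (v \<bullet> j) *\<^sub>R j)"
    by (simp add: euclidean_representation)
  also have "\<dots> = (\<Sum>i\<in>Basis. \<Sum>j\<in>Basis. b ((u \<bullet> i) *\<^sub>R i) ((v \<bullet> j) *\<^sub>R j))"
    by (simp add: bilinear_sum[OF assms] sum.cartesian_product)
  also have "\<dots> = (\<Sum>i\<in>Basis. \<Sum>j\<in>Basis. (u \<bullet> i) * (v \<bullet> j) * b i j)"
    by (simp add: bilinear_lmul[OF assms] bilinear_rmul[OF assms] ac_simps)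
  finally show ?thesis .
qed

text \<open>Every linear relation that \<open>H y\<close> satisfies for all \<open>y\<close> near
  \<open>x\<close> passes to the derivatives, by their uniqueness.\<close>

lemma bilinear_derivative:
  fixes H :: "'c::real_normed_vector \<Rightarrow> 'a::real_vector \<Rightarrow> 'b::real_vector \<Rightarrow> real"
  assumes "open S" "x \<in> S" and bil: "\<And>y. y \<in> S \<Longrightarrow> bilinear (H y)"
    and H': "\<And>u v. ((\<lambda>y. H y u v) has_derivative H' u v) (at x)"
  shows "bilinear (\<lambda>u v. H' u v t)"
proof -
  have eq: "H' u v = F'" if "(F has_derivative F') (at x)" "\<And>y. y \<in> S \<Longrightarrow> H y u v = F y" for u v F F'
    using has_derivative_unique[OF H' has_derivative_transform_within_open[OF that(1) assms(1,2)]] that(2)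
    by simp
  have "H' (u + u') v = (\<lambda>t. H' u v t + H' u' v t)" for u u' v
    by (rule eq[OF has_derivative_add[OF H'[of u v] H'[of u' v]]]) (simp add: bilinear_ladd[OF bil])
  moreover have "H' u (v + v') = (\<lambda>t. H' u v t + H' u v' t)" for u v v'
    by (rule eq[OF has_derivative_add[OF H'[of u v] H'[of u v']]]) (simp add: bilinear_radd[OF bil])
  moreover have "H' (c *\<^sub>R u) v = (\<lambda>t. c * H' u v t)" for u v c
    by (rule eq[OF has_derivative_mult_right[OF H'[of u v]]]) (simp add: bilinear_lmul[OF bil])
  moreover have "H' u (c *\<^sub>R v) = (\<lambda>t. c * H' u v t)" for u v c
    by (rule eq[OF has_derivative_mult_right[OF H'[of u v]]]) (simp add: bilinear_rmul[OF bil])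
  ultimately show ?thesis
    unfolding bilinear_def by (auto intro!: linearI)
qed

text \<open>The product rule when \<open>H\<close> is only known to be differentiable for fixed
  arguments: in the standard bases \<open>H y (a y) (b y)\<close> is a finite sum of products of
  three scalar functions.\<close>

lemma bilinear_field_has_derivative:
  fixes H :: "'c::real_normed_vector \<Rightarrow> 'a::euclidean_space \<Rightarrow> 'b::euclidean_space \<Rightarrow> real"
  assumes "open S" "x \<in> S" and bil: "\<And>y. y \<in> S \<Longrightarrow> bilinear (H y)"
    and H': "\<And>u v. ((\<lambda>y. H y u v) has_derivative H' u v) (at x)"
    and a': "(a has_derivative a') (at x)" and b': "(b has_derivative b') (at x)"
  shows "((\<lambda>y. H y (a y) (b y)) has_derivative
    (\<lambda>t. H' (a x) (b x) t + H x (a' t) (b x) + H x (a x) (b' t))) (at x)"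
proof -
  have e: "H x (a' t) (b x) = (\<Sum>i\<in>Basis. \<Sum>j\<in>Basis. (a' t \<bullet> i) * (b x \<bullet> j) * H x i j)"
    "H x (a x) (b' t) = (\<Sum>i\<in>Basis. \<Sum>j\<in>Basis. (a x \<bullet> i) * (b' t \<bullet> j) * H x i j)"
    "H' (a x) (b x) t = (\<Sum>i\<in>Basis. \<Sum>j\<in>Basis. (a x \<bullet> i) * (b x \<bullet> j) * H' i j t)" for t
    using bilinear_expansion[OF bil[OF assms(2)]] bilinear_expansion[OF bilinear_derivative[OF assms(1-4)]]
    by blast+
  have "((\<lambda>y. \<Sum>i\<in>Basis. \<Sum>j\<in>Basis. (a y \<bullet> i) * (b y \<bullet> j) * H y i j) has_derivative
    (\<lambda>t. \<Sum>i\<in>Basis. \<Sum>j\<in>Basis. (a x \<bullet> i) * (b x \<bullet> j) * H' i j t +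
        ((a x \<bullet> i) * (b' t \<bullet> j) + (a' t \<bullet> i) * (b x \<bullet> j)) * H x i j)) (at x)"
    by (intro has_derivative_sum has_derivative_mult has_derivative_inner_left a' b' H')
  also have "(\<lambda>t. \<Sum>i\<in>Basis. \<Sum>j\<in>Basis. (a x \<bullet> i) * (b x \<bullet> j) * H' i j t +
        ((a x \<bullet> i) * (b' t \<bullet> j) + (a' t \<bullet> i) * (b x \<bullet> j)) * H x i j)
    = (\<lambda>t. H' (a x) (b x) t + H x (a' t) (b x) + H x (a x) (b' t))"
    unfolding e sum.distrib[symmetric] by (intro ext sum.cong refl) (simp add: algebra_simps)
  finally show ?thesis
    by (rule has_derivative_transform_within_open[OF _ assms(1,2)])
      (rule bilinear_expansion[OF bil, symmetric])
qed

lemma bilinear_lsum: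
  assumes "bilinear b"
  shows "b (sum g E) w = (\<Sum>e\<in>E. b (g e) w)"
  using assms by (intro linear_sum[of "\<lambda>u. b u w"]) (simp add: bilinear_def)

section \<open>Inner products, dual vectors and orthonormal bases\<close>

definition inner_form :: "('a::real_vector \<Rightarrow> 'a \<Rightarrow> real) \<Rightarrow> bool" where
  "inner_form b \<longleftrightarrow> bilinear b \<and> (\<forall>u v. b u v = b v u) \<and> (\<forall>u. u \<noteq> 0 \<longrightarrow> 0 < b u u)"

text \<open>The musical isomorphism of \<open>b\<close>, with the same description operator as in
  \<open>christoffel\<close>; Christoffel symbols and gradients are both instances of it.\<close>

definition sharp :: "('a::real_vector \<Rightarrow> 'a \<Rightarrow> real) \<Rightarrow> ('a \<Rightarrow> real) \<Rightarrow> 'a" where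
  "sharp b l = (THE z. \<forall>w. b z w = l w)"

lemma inner_form_bilinear: "inner_form b \<Longrightarrow> bilinear b"
  by (simp add: inner_form_def)

lemma inner_form_eqI:
  assumes "inner_form b" "\<And>w. b z w = b z' w"
  shows "z = z'"
proof -
  have "b (z - z') (z - z') = 0"
    using assms(2) by (simp add: bilinear_lsub[OF inner_form_bilinear[OF assms(1)]])
  then show ?thesis
    using assms(1) by (metis eq_iff_diff_eq_0 inner_form_def less_irrefl)
qed

lemma sharp_eqI:
  assumes "inner_form b" "\<And>w. b z w = l w"
  shows "sharp b l = z"
  unfolding sharp_def using assms by (intro the_equality) (auto intro: inner_form_eqI)

text \<open>Pairing with an element of \<open>E\<close> recovers the coefficient of a linear
  combination. This gives independence, hence a basis by cardinality, and it identifies the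
  coefficients.\<close>

lemma orthonormal_basis_expansion:
  assumes "bilinear b" "orthonormal_basis b E"
  shows "z = (\<Sum>e\<in>E. b z e *\<^sub>R e)"
proof -
  have fin: "finite E" and card: "card E = DIM('a)"
    and on: "\<And>u v. u \<in> E \<Longrightarrow> v \<in> E \<Longrightarrow> b u v = (if u = v then 1 else 0)"
    using assms(2) by (auto simp: orthonormal_basis_def)
  have coeff: "b (\<Sum>e\<in>E. c e *\<^sub>R e) e' = c e'" if "e' \<in> E" for c e'
  proof -
    have "b (\<Sum>e\<in>E. c e *\<^sub>R e) e' = (\<Sum>e\<in>E. c e * b e e')"
      by (simp add: bilinear_lsum[OF assms(1)] bilinear_lmul[OF assms(1)])
    also have "\<dots> = (\<Sum>e\<in>E. if e = e' then c e else 0)"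
      using that by (intro sum.cong) (auto simp: on)
    finally show ?thesis
      using fin that by simp
  qed
  have "independent E"
    using coeff bilinear_lzero[OF assms(1)] by (intro independent_if_scalars_zero fin) metis
  then have "UNIV \<subseteq> span E"
    using card by (intro card_ge_dim_independent) auto
  then obtain c where "z = (\<Sum>e\<in>E. c e *\<^sub>R e)"
    using span_finite[OF fin] by (metis (mono_tags, lifting) UNIV_I imageE subsetD)
  then show ?thesis
    using coeff by (metis (no_types, lifting) sum.cong)
qed

text \<open>The set chosen in \<open>metric_trace\<close> depends on \<open>b\<close> alone, so one
  \<open>E'\<close> computes the traces of all \<open>T\<close>. The existence of some
  \<open>E\<close> guarantees that the chosen set is orthonormal.\<close>

lemma metric_trace_orthonormal:
  fixes b :: "'a::euclidean_space \<Rightarrow> 'a \<Rightarrow> real"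
  assumes "orthonormal_basis b E"
  obtains E' where "orthonormal_basis b E'"
    "\<And>T :: 'a \<Rightarrow> 'a \<Rightarrow> 'c::real_vector. metric_trace b T = (\<Sum>e\<in>E'. T e e)"
  using someI[of "orthonormal_basis b", OF assms] that unfolding metric_trace_def by blast

section \<open>The Levi-Civita connection of a metric on an open set\<close>

definition koszul :: "'e::euclidean_space local_metric \<Rightarrow> 'e \<Rightarrow> 'e \<Rightarrow> 'e \<Rightarrow> 'e \<Rightarrow> real" where
  "koszul G x u v w =
    D (\<lambda>y. G y v w) x u + D (\<lambda>y. G y u w) x v - D (\<lambda>y. G y u v) x w"

text \<open>Reduces existence and differentiability of the Christoffel symbols to those of dual
  vectors.\<close>

lemma christoffel_eq_sharp: "christoffel G x u v = sharp (G x) (\<lambda>w. koszul G x u v w / 2)"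
  unfolding christoffel_def sharp_def koszul_def by (rule arg_cong[where f = The]) (auto simp: field_simps)

lemma christoffel_eqI:
  assumes "inner_form (G x)" "\<And>w. 2 * G x z w = koszul G x u v w"
  shows "christoffel G x u v = z"
  unfolding christoffel_eq_sharp using assms(2) by (intro sharp_eqI assms(1)) (simp add: field_simps)

locale metric_field =
  fixes S :: "'e::euclidean_space set" and G :: "'e local_metric"
  assumes open_S: "open S"
    and inner: "x \<in> S \<Longrightarrow> inner_form (G x)"
    and smooth: "smooth_on S (\<lambda>x. G x u v)"
begin

lemma bil: "x \<in> S \<Longrightarrow> bilinear (G x)"
  using inner inner_form_bilinear by blast

lemma sym: "x \<in> S \<Longrightarrow> G x u v = G x v u"
  using inner unfolding inner_form_def by blast

lemma pos: "x \<in> S \<Longrightarrow> u \<noteq> 0 \<Longrightarrow> 0 < G x u u"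
  using inner unfolding inner_form_def by blast

lemma has_derivative: "x \<in> S \<Longrightarrow> ((\<lambda>y. G y u v) has_derivative D (\<lambda>y. G y u v) x) (at x)"
  by (intro differentiable_on_has_derivative[OF open_S] smooth_on_differentiable smooth)

lemma bilinear_D: "x \<in> S \<Longrightarrow> bilinear (\<lambda>u v. D (\<lambda>y. G y u v) x t)"
  by (rule bilinear_derivative[OF open_S _ bil has_derivative])

lemma linear_D: "x \<in> S \<Longrightarrow> linear (D (\<lambda>y. G y u v) x)"
  using has_derivative has_derivative_linear by blast

lemma D_sym: "x \<in> S \<Longrightarrow> D (\<lambda>y. G y u v) x = D (\<lambda>y. G y v u) x"
  by (rule D_cong_open[OF open_S _ sym])

lemma has_derivative_metric:
  assumes "x \<in> S" "(a has_derivative a') (at x)" "(b has_derivative b') (at x)"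
  shows "((\<lambda>y. G y (a y) (b y)) has_derivative
    (\<lambda>t. D (\<lambda>y. G y (a x) (b x)) x t + G x (a' t) (b x) + G x (a x) (b' t))) (at x)"
  by (rule bilinear_field_has_derivative[OF open_S assms(1) bil has_derivative[OF assms(1)] assms(2,3)])

lemma differentiable_metric:
  assumes "a differentiable_on S" "b differentiable_on S"
  shows "(\<lambda>y. G y (a y) (b y)) differentiable_on S"
  using has_derivative_metric[OF _ differentiable_on_has_derivative[OF open_S assms(1)]
      differentiable_on_has_derivative[OF open_S assms(2)]]
  by (meson differentiableI differentiable_at_imp_differentiable_on)

text \<open>Gram--Schmidt applied at every point of \<open>S\<close> to the standard basis.\<close>

lemma orthonormal_frame_subset:
  assumes "finite I" "I \<subseteq> Basis"
  shows "\<exists>E. (\<forall>b\<in>I. (\<lambda>x. E x b) differentiable_on S) \<and>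
    (\<forall>x\<in>S. \<forall>b\<in>I. E x b \<in> span I \<and> (\<forall>c\<in>I. G x (E x b) (E x c) = (if b = c then 1 else 0)))"
  using assms
proof (induction I rule: finite_induct)
  case empty
  then show ?case by simp
next
  case (insert k I)
  then obtain E where E: "\<forall>b\<in>I. (\<lambda>x. E x b) differentiable_on S"
    "\<forall>x\<in>S. \<forall>b\<in>I. E x b \<in> span I \<and> (\<forall>c\<in>I. G x (E x b) (E x c) = (if b = c then 1 else 0))"
    by auto
  then have diff: "\<And>b. b \<in> I \<Longrightarrow> (\<lambda>x. E x b) differentiable_on S"
    and sp: "\<And>x b. x \<in> S \<Longrightarrow> b \<in> I \<Longrightarrow> E x b \<in> span I"
    and on: "\<And>x b c. x \<in> S \<Longrightarrow> b \<in> I \<Longrightarrow> c \<in> I \<Longrightarrow> G x (E x b) (E x c) = (if b = c then 1 else 0)"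
    by auto
  define w where "w x = k - (\<Sum>c\<in>I. G x k (E x c) *\<^sub>R E x c)" for x
  define r where "r x = G x (w x) (w x)" for x
  define E' where "E' x b = (if b = k then inverse (sqrt (r x)) *\<^sub>R w x else E x b)" for x b
  \<comment> \<open>The span clause of the induction serves this purpose: the part subtracted from
    \<open>k\<close> lies in \<open>span I\<close>, so \<open>w\<close> vanishes nowhere on
    \<open>S\<close> and can be normalized.\<close>
  have "k \<notin> span I"
  proof
    assume "k \<in> span I"
    then have "k \<in> span (Basis - {k})"
      using insert.hyps insert.prems by (metis Diff_empty insert_subset span_mono subset_Diff_insert subsetD)
    then show False
      using independent_Basis insert.prems by (auto simp: dependent_def)
  qed
  moreover have "(\<Sum>c\<in>I. G x k (E x c) *\<^sub>R E x c) \<in> span I" if "x \<in> S" for x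
    by (intro span_sum span_scale sp that)
  ultimately have w0: "w x \<noteq> 0" if "x \<in> S" for x
    using that by (metis w_def eq_iff_diff_eq_0)
  have r: "r x > 0" if "x \<in> S" for x
    unfolding r_def using pos that w0 by blast
  have wE: "G x (w x) (E x c) = 0" if "x \<in> S" "c \<in> I" for x c
  proof -
    have "G x (\<Sum>d\<in>I. G x k (E x d) *\<^sub>R E x d) (E x c) = (\<Sum>d\<in>I. G x k (E x d) * G x (E x d) (E x c))"
      by (simp add: bilinear_lsum[OF bil[OF that(1)]] bilinear_lmul[OF bil[OF that(1)]])
    also have "\<dots> = (\<Sum>d\<in>I. if d = c then G x k (E x d) else 0)"
      using that by (intro sum.cong) (auto simp: on)
    also have "\<dots> = G x k (E x c)"
      using insert.hyps that by simp
    finally show ?thesis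
      unfolding w_def by (simp add: bilinear_lsub[OF bil[OF that(1)]])
  qed
  have wdiff: "w differentiable_on S"
    unfolding w_def[abs_def]
    by (intro differentiable_on_diff differentiable_on_const differentiable_on_sum
        differentiable_on_scaleR differentiable_metric diff insert.hyps)
  then have "r differentiable_on S"
    unfolding r_def[abs_def] by (intro differentiable_metric)
  then have "(\<lambda>x. inverse (sqrt (r x))) differentiable (at x)" if "x \<in> S" for x
    using differentiable_on_has_derivative[OF open_S _ that, of r] r[OF that]
    by (auto intro!: differentiableI derivative_eq_intros)
  then have "(\<lambda>x. inverse (sqrt (r x)) *\<^sub>R w x) differentiable_on S"
    by (intro differentiable_on_scaleR wdiff) (simp add: differentiable_at_imp_differentiable_on)
  then have diff': "(\<lambda>x. E' x b) differentiable_on S" if "b \<in> insert k I" for b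
    using that diff by (cases "b = k") (auto simp: E'_def[abs_def])
  have neq: "b \<noteq> k" if "b \<in> I" for b
    using that insert.hyps by blast
  have on': "G x (E' x b) (E' x c) = (if b = c then 1 else 0)"
    if "x \<in> S" "b \<in> insert k I" "c \<in> insert k I" for x b c
  proof -
    note [simp] = bilinear_lmul[OF bil[OF that(1)]] bilinear_rmul[OF bil[OF that(1)]]
    have "inverse (sqrt (r x)) * (inverse (sqrt (r x)) * r x) = 1"
      using r[OF that(1)] by (simp add: field_simps)
    then show ?thesis
      using that wE[OF that(1)] sym[OF that(1)] on neq
      by (auto simp: E'_def r_def)
  qed
  have sp': "E' x b \<in> span (insert k I)" if "x \<in> S" "b \<in> insert k I" for x b
  proof -
    have "w x \<in> span (insert k I)"
      unfolding w_def using that sp span_mono[of I "insert k I"]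
      by (intro span_diff span_sum span_scale) (auto simp: span_base)
    then show ?thesis
      using that sp span_mono[of I "insert k I"] by (auto simp: E'_def span_scale)
  qed
  show ?case
    using diff' on' sp' by (intro exI[of _ E']) auto
qed

lemma orthonormal_frame:
  "\<exists>E :: 'e \<Rightarrow> 'e \<Rightarrow> 'e. (\<forall>b\<in>Basis. (\<lambda>x. E x b) differentiable_on S) \<and>
    (\<forall>x\<in>S. inj_on (E x) Basis \<and> orthonormal_basis (G x) (E x ` Basis))"
proof -
  obtain E where diff: "\<forall>b\<in>(Basis :: 'e set). (\<lambda>x. E x b) differentiable_on S"
    and E: "\<forall>x\<in>S. \<forall>b\<in>Basis. E x b \<in> span Basis \<and>
      (\<forall>c\<in>Basis. G x (E x b) (E x c) = (if b = c then 1 else 0))"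
    using orthonormal_frame_subset[OF finite_Basis order_refl] by blast
  have "inj_on (E x) Basis" if "x \<in> S" for x
    using E that by (intro inj_onI) (metis zero_neq_one)
  moreover from this have "orthonormal_basis (G x) (E x ` Basis)" if "x \<in> S" for x
    using that E by (auto simp: orthonormal_basis_def card_image dest: inj_onD)
  ultimately show ?thesis
    using diff by blast
qed

lemma ex_orthonormal_basis: "x \<in> S \<Longrightarrow> \<exists>E. orthonormal_basis (G x) E"
  using orthonormal_frame by blast

lemma metric_frame_sum:
  assumes "x \<in> S" "linear l" "orthonormal_basis (G x) E"
  shows "G x (\<Sum>e\<in>E. l e *\<^sub>R e) w = l w"
proof -
  have "l w = l (\<Sum>e\<in>E. G x w e *\<^sub>R e)"
    using orthonormal_basis_expansion[OF bil[OF assms(1)] assms(3)] by metis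
  also have "\<dots> = (\<Sum>e\<in>E. G x w e * l e)"
    by (simp add: linear_sum[OF assms(2)] linear_cmul[OF assms(2)])
  also have "\<dots> = G x (\<Sum>e\<in>E. l e *\<^sub>R e) w"
    by (simp add: bilinear_lsum[OF bil[OF assms(1)]] bilinear_lmul[OF bil[OF assms(1)]]
        sym[OF assms(1), of w] mult.commute)
  finally show ?thesis by simp
qed

lemma sharp_frame:
  assumes "x \<in> S" "linear l" "orthonormal_basis (G x) E"
  shows "sharp (G x) l = (\<Sum>e\<in>E. l e *\<^sub>R e)"
  by (rule sharp_eqI[OF inner[OF assms(1)] metric_frame_sum[OF assms]])

lemma sharp_works:
  assumes "x \<in> S" "linear l"
  shows "G x (sharp (G x) l) w = l w"
proof -
  obtain E where E: "orthonormal_basis (G x) E"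
    using ex_orthonormal_basis assms(1) by blast
  show ?thesis
    unfolding sharp_frame[OF assms E] by (rule metric_frame_sum[OF assms E])
qed

text \<open>In an orthonormal frame the dual vector is the sum of \<open>l x e *\<^sub>R e\<close>,
  and with a differentiable frame this formula shows differentiability.\<close>

lemma differentiable_sharp:
  assumes lin: "\<And>x. x \<in> S \<Longrightarrow> linear (l x)" and diff: "\<And>w. (\<lambda>x. l x w) differentiable_on S"
  shows "(\<lambda>x. sharp (G x) (l x)) differentiable_on S"
proof -
  obtain E :: "'e \<Rightarrow> 'e \<Rightarrow> 'e" where E: "\<forall>b\<in>Basis. (\<lambda>x. E x b) differentiable_on S"
    and on: "\<forall>x\<in>S. inj_on (E x) Basis \<and> orthonormal_basis (G x) (E x ` Basis)"
    using orthonormal_frame by blast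
  have lE: "l x v = (\<Sum>c\<in>Basis. (v \<bullet> c) * l x c)" if "x \<in> S" for x v
  proof -
    have "l x v = l x (\<Sum>c\<in>Basis. (v \<bullet> c) *\<^sub>R c)"
      by (simp add: euclidean_representation)
    also have "\<dots> = (\<Sum>c\<in>Basis. (v \<bullet> c) * l x c)"
      unfolding linear_sum[OF lin[OF that]] linear_cmul[OF lin[OF that]] by simp
    finally show ?thesis .
  qed
  \<comment> \<open>Here the argument of \<open>l x\<close> moves with \<open>x\<close>, while
    \<open>diff\<close> concerns fixed arguments; hence the expansion \<open>lE\<close> in the
    constant basis.\<close>
  have "(\<lambda>x. l x (E x b)) differentiable_on S" if "b \<in> Basis" for b
  proof -
    have "(\<lambda>x. E x b \<bullet> c) differentiable_on S" for c
      using E that by (simp add: differentiable_on_def)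
    then have "(\<lambda>x. \<Sum>c\<in>Basis. (E x b \<bullet> c) * l x c) differentiable_on S"
      using diff by (intro differentiable_on_sum differentiable_on_mult) simp_all
    then show ?thesis
      by (rule differentiable_on_transform) (rule lE)
  qed
  then have "(\<lambda>x. \<Sum>b\<in>Basis. l x (E x b) *\<^sub>R E x b) differentiable_on S"
    using E by (intro differentiable_on_sum differentiable_on_scaleR) simp_all
  moreover have "sharp (G x) (l x) = (\<Sum>b\<in>Basis. l x (E x b) *\<^sub>R E x b)" if "x \<in> S" for x
  proof -
    have "inj_on (E x) Basis" "orthonormal_basis (G x) (E x ` Basis)"
      using on that by blast+
    then show ?thesis
      using sharp_frame[OF that lin[OF that]] sum.reindex[of "E x" Basis "\<lambda>e. l x e *\<^sub>R e"]
      by (simp add: o_def)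
  qed
  ultimately show ?thesis
    by (rule differentiable_on_transform)
qed

lemma linear_koszul:
  assumes "x \<in> S"
  shows "linear (koszul G x u v)"
  using bilinear_D[OF assms] linear_D[OF assms] unfolding koszul_def[abs_def]
  by (intro linearI) (simp_all add: bilinear_radd[OF bilinear_D[OF assms]] bilinear_rmul[OF bilinear_D[OF assms]]
        linear_add linear_cmul algebra_simps)

lemma christoffel_works:
  assumes "x \<in> S"
  shows "2 * G x (christoffel G x u v) w = koszul G x u v w"
proof -
  have "linear (\<lambda>w. koszul G x u v w / 2)"
    using linear_koszul[OF assms] by (intro linearI) (simp_all add: linear_add linear_cmul add_divide_distrib)
  from sharp_works[OF assms this] show ?thesis
    by (simp add: christoffel_eq_sharp field_simps)
qed

text \<open>One derivative of the symbols is what the curvature involves.\<close>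

lemma christoffel_differentiable: "(\<lambda>x. christoffel G x u v) differentiable_on S"
  unfolding christoffel_eq_sharp
proof (rule differentiable_sharp)
  show "linear (\<lambda>w. koszul G x u v w / 2)" if "x \<in> S" for x
    using linear_koszul[OF that] by (intro linearI) (simp_all add: linear_add linear_cmul add_divide_distrib)
  show "(\<lambda>x. koszul G x u v w / 2) differentiable_on S" for w
    unfolding koszul_def divide_inverse
    by (intro differentiable_on_mult differentiable_on_const differentiable_on_diff differentiable_on_add
        smooth_on_differentiable smooth_on_D smooth)
qed

lemma christoffel_sym:
  assumes "x \<in> S"
  shows "christoffel G x u v = christoffel G x v u"
  unfolding christoffel_eq_sharp koszul_def D_sym[OF assms, of u v] by (simp add: add.commute)

lemma christoffel_scaleR_right:
  assumes "x \<in> S"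
  shows "christoffel G x u (c *\<^sub>R v) = c *\<^sub>R christoffel G x u v"
proof (rule christoffel_eqI)
  show "inner_form (G x)" by (rule inner[OF assms])
  have "koszul G x u (c *\<^sub>R v) w = c * koszul G x u v w" for w
    by (simp add: koszul_def bilinear_lmul[OF bilinear_D[OF assms]]
        bilinear_rmul[OF bilinear_D[OF assms]] linear_cmul[OF linear_D[OF assms]] algebra_simps)
  then show "2 * G x (c *\<^sub>R christoffel G x u v) w = koszul G x u (c *\<^sub>R v) w" for w
    by (simp add: bilinear_lmul[OF bil[OF assms]] christoffel_works[OF assms, symmetric])
qed

lemma christoffel_zero_right: "x \<in> S \<Longrightarrow> christoffel G x u 0 = 0"
  using christoffel_scaleR_right[of x u 0] by simp

lemma christoffel_zero_left: "x \<in> S \<Longrightarrow> christoffel G x 0 v = 0"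
  using christoffel_zero_right christoffel_sym by metis

end

lemma Ck_on_const: "Ck_on k S (\<lambda>_. c)"
  by (induction k arbitrary: c) simp_all

lemma smooth_on_ident: "smooth_on S (\<lambda>x. x)"
  unfolding smooth_on_def
proof
  show "Ck_on k S (\<lambda>x. x)" for k
    by (cases k) (simp_all add: Ck_on_const)
qed

section \<open>Isometries\<close>

text \<open>The transformation law of the Christoffel symbols. Differentiating the isometry
  condition brings six terms with second derivatives of \<open>\<psi>\<close> into the Koszul
  formula. By their symmetry four of them cancel, and the other two add up to
  \<open>2 * k (\<psi> x) (H v u) (?P w)\<close>.\<close>

lemma christoffel_isometry:
  fixes \<psi> :: "'e::euclidean_space \<Rightarrow> 'e"
  assumes h: "metric_field S h" and k: "metric_field S' k"
    and U: "open U" "U \<subseteq> S" "\<psi> ` U \<subseteq> S'" and \<psi>: "smooth_on U \<psi>"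
    and iso: "\<And>y u v. y \<in> U \<Longrightarrow> h y u v = k (\<psi> y) (D \<psi> y u) (D \<psi> y v)"
    and x: "x \<in> U"
  shows "D (\<lambda>y. D \<psi> y v) x u + christoffel k (\<psi> x) (D \<psi> x u) (D \<psi> x v)
    = D \<psi> x (christoffel h x u v)"
proof -
  interpret h: metric_field S h by (rule h)
  interpret k: metric_field S' k by (rule k)
  have xS: "x \<in> S" and \<psi>x: "\<psi> x \<in> S'"
    using U x by auto
  have d\<psi>: "(\<psi> has_derivative D \<psi> x) (at x)"
    by (intro differentiable_on_has_derivative[OF U(1) _ x] smooth_on_differentiable \<psi>)
  define H where "H v = D (\<lambda>y. D \<psi> y v) x" for v
  have d2: "((\<lambda>y. D \<psi> y v) has_derivative H v) (at x)" for v
    unfolding H_def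
    by (intro differentiable_on_has_derivative[OF U(1) _ x] smooth_on_differentiable smooth_on_D \<psi>)
  have H_sym: "H u v = H v u" for u v
    unfolding H_def by (rule symmetric_second_derivative[OF U(1) x \<psi>])
  have lin: "linear (D \<psi> x)"
    using d\<psi> has_derivative_linear by blast
  have bilk: "bilinear (k (\<psi> y))" if "y \<in> U" for y
    using k.bil U(3) that by blast
  define K where "K a b = D (\<lambda>z. k z a b) (\<psi> x)" for a b
  have dk: "((\<lambda>y. k (\<psi> y) a b) has_derivative (\<lambda>t. K a b (D \<psi> x t))) (at x)" for a b
    unfolding K_def using diff_chain_at[OF d\<psi> k.has_derivative[OF \<psi>x]] by (simp add: o_def)
  let ?P = "D \<psi> x"
  have Dh: "D (\<lambda>y. h y v w) x u
      = K (?P v) (?P w) (?P u) + k (\<psi> x) (H v u) (?P w) + k (\<psi> x) (?P v) (H w u)" for u v w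
  proof -
    have "D (\<lambda>y. h y v w) x = D (\<lambda>y. k (\<psi> y) (D \<psi> y v) (D \<psi> y w)) x"
      by (rule D_cong_open[OF U(1) x iso])
    also have "\<dots> = (\<lambda>u. K (?P v) (?P w) (?P u) + k (\<psi> x) (H v u) (?P w) + k (\<psi> x) (?P v) (H w u))"
      by (rule D_eq[OF bilinear_field_has_derivative[OF U(1) x bilk dk d2 d2]])
    finally show ?thesis by simp
  qed
  have "koszul h x u v w = koszul k (\<psi> x) (?P u) (?P v) (?P w) + 2 * k (\<psi> x) (H v u) (?P w)" for w
    unfolding koszul_def Dh K_def[symmetric]
    using k.sym[OF \<psi>x] H_sym by simp
  then have "2 * k (\<psi> x) (?P (christoffel h x u v)) (?P w)
      = 2 * k (\<psi> x) (H v u + christoffel k (\<psi> x) (?P u) (?P v)) (?P w)" for w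
    using iso[OF x] h.christoffel_works[OF xS, of u v w] k.christoffel_works[OF \<psi>x, of "?P u" "?P v" "?P w"]
    by (simp add: bilinear_ladd[OF bilk[OF x]])
  \<comment> \<open>So far the identity has been tested only against vectors \<open>?P w\<close>. An
    isometry has injective differential, which is surjective because source and target have the same
    dimension.\<close>
  moreover have "surj ?P"
  proof (rule linear_inj_imp_surj[OF lin])
    show "inj ?P"
      unfolding linear_injective_0[OF lin]
    proof (intro allI impI)
      fix a assume "?P a = 0"
      then have "h x a a = 0"
        using iso[OF x, of a a] bilinear_lzero[OF bilk[OF x]] by simp
      then show "a = 0"
        using h.pos[OF xS, of a] by force
    qed
  qed
  ultimately have "k (\<psi> x) (?P (christoffel h x u v)) w
      = k (\<psi> x) (H v u + christoffel k (\<psi> x) (?P u) (?P v)) w" for w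
    using surjD[of ?P w] by auto
  then have "?P (christoffel h x u v) = H v u + christoffel k (\<psi> x) (?P u) (?P v)"
    by (rule inner_form_eqI[OF k.inner[OF \<psi>x]])
  then show ?thesis
    unfolding H_def by simp
qed

section \<open>Warped products in a chart\<close>

lemma has_derivative_comp_fst:
  "(F has_derivative F') (at (fst p)) \<Longrightarrow> ((\<lambda>p. F (fst p)) has_derivative (\<lambda>t. F' (fst t))) (at p)"
  using diff_chain_at[of fst fst p F F']
  by (simp add: o_def bounded_linear_imp_has_derivative bounded_linear_fst)

lemma has_derivative_comp_snd:
  "(F has_derivative F') (at (snd p)) \<Longrightarrow> ((\<lambda>p. F (snd p)) has_derivative (\<lambda>t. F' (snd t))) (at p)"
  using diff_chain_at[of snd snd p F F']
  by (simp add: o_def bounded_linear_imp_has_derivative bounded_linear_snd)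

text \<open>Written with \<open>L\<close> for the squared warping function, so that the metric is
  linear in \<open>L\<close> and only \<open>L\<close> gets differentiated.\<close>

definition warp :: "'a local_metric \<Rightarrow> ('a \<Rightarrow> real) \<Rightarrow> 'b local_metric \<Rightarrow> ('a \<times> 'b) local_metric" where
  "warp g L h p u v = g (fst p) (fst u) (fst v) + L (fst p) * h (snd p) (snd u) (snd v)"

locale warped_chart = M: metric_field S1 g + N: metric_field S2 h
  for S1 :: "'a::euclidean_space set" and g and S2 :: "'b::euclidean_space set" and h +
  fixes L :: "'a \<Rightarrow> real"
  assumes L_diff: "L differentiable_on S1"
    and DL_diff: "(\<lambda>x. D L x v) differentiable_on S1"
    and L_pos: "x \<in> S1 \<Longrightarrow> 0 < L x"
begin

abbreviation "K \<equiv> warp g L h"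

definition grad_L :: "'a \<Rightarrow> 'a" where
  "grad_L x = sharp (g x) (D L x)"

lemma L_has_derivative: "x \<in> S1 \<Longrightarrow> (L has_derivative D L x) (at x)"
  by (rule differentiable_on_has_derivative[OF M.open_S L_diff])

lemma linear_DL: "x \<in> S1 \<Longrightarrow> linear (D L x)"
  using L_has_derivative has_derivative_linear by blast

lemma grad_L_works: "x \<in> S1 \<Longrightarrow> g x (grad_L x) w = D L x w"
  unfolding grad_L_def using M.sharp_works linear_DL by blast

lemma grad_L_diff: "grad_L differentiable_on S1"
  unfolding grad_L_def[abs_def] by (intro M.differentiable_sharp linear_DL DL_diff)

lemma open_S1_S2: "open (S1 \<times> S2)"
  by (intro open_Times M.open_S N.open_S)

lemma inner_K:
  assumes "p \<in> S1 \<times> S2"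
  shows "inner_form (K p)"
proof -
  obtain x y where p: "p = (x, y)" and x: "x \<in> S1" and y: "y \<in> S2"
    using assms by auto
  note b1 = M.bil[OF x] and b2 = N.bil[OF y]
  have "bilinear (K p)"
    unfolding bilinear_def p warp_def
    by (auto intro!: linearI simp: bilinear_ladd[OF b1] bilinear_ladd[OF b2] bilinear_radd[OF b1]
      bilinear_radd[OF b2] bilinear_lmul[OF b1] bilinear_lmul[OF b2] bilinear_rmul[OF b1]
      bilinear_rmul[OF b2] algebra_simps)
  moreover have "K p u v = K p v u" for u v
    using M.sym[OF x] N.sym[OF y] by (simp add: warp_def p)
  moreover have "0 < K p u u" if "u \<noteq> 0" for u
  proof -
    have 1: "0 \<le> g x a a" "a \<noteq> 0 \<Longrightarrow> 0 < g x a a" for a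
      using M.pos[OF x, of a] bilinear_lzero[OF b1] by (cases "a = 0"; simp)+
    have 2: "0 \<le> L x * h y a a" "a \<noteq> 0 \<Longrightarrow> 0 < L x * h y a a" for a
      using N.pos[OF y, of a] bilinear_lzero[OF b2] L_pos[OF x] by (cases "a = 0"; simp)+
    have "fst u \<noteq> 0 \<or> snd u \<noteq> 0"
      using that by (simp add: prod_eq_iff)
    then show ?thesis
      using 1 2 by (auto simp: warp_def p intro: add_pos_nonneg add_nonneg_pos)
  qed
  ultimately show ?thesis
    unfolding inner_form_def by blast
qed

lemma D_K:
  assumes x: "x \<in> S1" and y: "y \<in> S2"
  shows "D (\<lambda>p. K p u v) (x, y) t =
    D (\<lambda>x. g x (fst u) (fst v)) x (fst t) + D L x (fst t) * h y (snd u) (snd v) +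
    L x * D (\<lambda>y. h y (snd u) (snd v)) y (snd t)"
proof -
  have 1: "((\<lambda>p. F (fst p)) has_derivative (\<lambda>t. F' (fst t))) (at (x, y))"
    if "(F has_derivative F') (at x)" for F F' :: "'a \<Rightarrow> real"
    using has_derivative_comp_fst[of F F' "(x, y)"] that by simp
  have 2: "((\<lambda>p. F (snd p)) has_derivative (\<lambda>t. F' (snd t))) (at (x, y))"
    if "(F has_derivative F') (at y)" for F F' :: "'b \<Rightarrow> real"
    using has_derivative_comp_snd[of F F' "(x, y)"] that by simp
  show ?thesis
    unfolding warp_def
    by (subst D_eq[OF has_derivative_add[OF 1[OF M.has_derivative[OF x]]
        has_derivative_mult[OF 1[OF L_has_derivative[OF x]] 2[OF N.has_derivative[OF y]]]]]) simp
qed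

text \<open>The candidate is checked against the Koszul formula. The derivative of \<open>L\<close>
  in the N-block of the metric accounts for the gradient term and for the mixed terms;
  \<open>D L x X / (2 * L x)\<close> is the derivative of the logarithm of the warping
  function.\<close>

lemma christoffel_K:
  assumes x: "x \<in> S1" and y: "y \<in> S2"
  shows "christoffel K (x, y) u v =
    (christoffel g x (fst u) (fst v) - (h y (snd u) (snd v) / 2) *\<^sub>R grad_L x,
     christoffel h y (snd u) (snd v) + (D L x (fst u) / (2 * L x)) *\<^sub>R snd v
       + (D L x (fst v) / (2 * L x)) *\<^sub>R snd u)"
    (is "_ = ?z")
proof (rule christoffel_eqI)
  show "inner_form (K (x, y))"
    using x y by (intro inner_K) simp
  fix w
  note b1 = M.bil[OF x] and b2 = N.bil[OF y]
  have L: "L x \<noteq> 0"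
    using L_pos[OF x] by simp
  have "2 * K (x, y) ?z w = 2 * g x (christoffel g x (fst u) (fst v)) (fst w)
      - h y (snd u) (snd v) * D L x (fst w)
      + L x * (2 * h y (christoffel h y (snd u) (snd v)) (snd w))
      + D L x (fst u) * h y (snd v) (snd w) + D L x (fst v) * h y (snd u) (snd w)"
    using L by (simp add: warp_def bilinear_lsub[OF b1] bilinear_lmul[OF b1] bilinear_ladd[OF b2]
        bilinear_lmul[OF b2] grad_L_works[OF x] field_simps)
  also have "\<dots> = koszul K (x, y) u v w"
    unfolding M.christoffel_works[OF x] N.christoffel_works[OF y]
    by (simp add: koszul_def D_K[OF x y] algebra_simps)
  finally show "2 * K (x, y) ?z w = koszul K (x, y) u v w" .
qed

lemma christoffel_K_vertical:
  assumes "x \<in> S1" "y \<in> S2"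
  shows "christoffel K (x, y) (0, u) (0, v) = (- (h y u v / 2) *\<^sub>R grad_L x, christoffel h y u v)"
  by (simp add: christoffel_K[OF assms] M.christoffel_zero_left[OF assms(1)] linear_0[OF linear_DL[OF assms(1)]])

lemma snd_christoffel_K_horizontal:
  assumes "x \<in> S1" "y \<in> S2"
  shows "snd (christoffel K (x, y) (T, 0) (X, v)) = (D L x T / (2 * L x)) *\<^sub>R v"
  by (simp add: christoffel_K[OF assms] N.christoffel_zero_left[OF assms(2)])

lemma christoffel_K_horizontal:
  assumes "x \<in> S1" "y \<in> S2"
  shows "christoffel K (x, y) (T, 0) (0, v) = (0, (D L x T / (2 * L x)) *\<^sub>R v)"
  by (simp add: christoffel_K[OF assms] N.christoffel_zero_left[OF assms(2)] M.christoffel_zero_right[OF assms(1)]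
      bilinear_lzero[OF N.bil[OF assms(2)]] linear_0[OF linear_DL[OF assms(1)]])

text \<open>The N-component in question is \<open>christoffel h y e e\<close>, which does not vary
  in the horizontal direction \<open>(T, 0)\<close>.\<close>

lemma snd_D_christoffel_vertical:
  assumes x: "x \<in> S1" and y: "y \<in> S2"
  shows "snd (D (\<lambda>p. christoffel K p (0, e) (0, e)) (x, y) (T, 0)) = 0"
proof -
  let ?X = "\<lambda>p. ((- (1 / 2) * h (snd p) e e) *\<^sub>R grad_L (fst p), christoffel h (snd p) e e)"
  have Z': "((\<lambda>p. grad_L (fst p)) has_derivative (\<lambda>t. D grad_L x (fst t))) (at (x, y))"
    using has_derivative_comp_fst[of grad_L "D grad_L x" "(x, y)"]
      differentiable_on_has_derivative[OF M.open_S grad_L_diff x] by simp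
  have h': "((\<lambda>p. h (snd p) e e) has_derivative (\<lambda>t. D (\<lambda>y. h y e e) y (snd t))) (at (x, y))"
    using has_derivative_comp_snd[of "\<lambda>y. h y e e" _ "(x, y)"] N.has_derivative[OF y] by simp
  have ch: "((\<lambda>y. christoffel h y e e) has_derivative D (\<lambda>y. christoffel h y e e) y) (at y)"
    by (rule differentiable_on_has_derivative[OF N.open_S N.christoffel_differentiable y])
  then have ch': "((\<lambda>p. christoffel h (snd p) e e) has_derivative
      (\<lambda>t. D (\<lambda>y. christoffel h y e e) y (snd t))) (at (x, y))"
    using has_derivative_comp_snd[of "\<lambda>y. christoffel h y e e" _ "(x, y)"] by simp
  have "D (\<lambda>p. christoffel K p (0, e) (0, e)) (x, y) = D ?X (x, y)"
    using x y by (intro D_cong_open[OF open_S1_S2]) (auto simp: christoffel_K_vertical)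
  moreover note D_eq[OF has_derivative_Pair[OF has_derivative_scaleR[OF
    has_derivative_mult_right[OF h', of "- (1 / 2)"] Z'] ch']]
  ultimately have "snd (D (\<lambda>p. christoffel K p (0, e) (0, e)) (x, y) (T, 0)) = D (\<lambda>y. christoffel h y e e) y 0"
    by simp
  then show ?thesis
    using linear_0[OF has_derivative_linear[OF ch]] by simp
qed

text \<open>The field differentiated here depends on the M-coordinate alone, and the direction is
  vertical.\<close>

lemma D_christoffel_horizontal:
  assumes x: "x \<in> S1" and y: "y \<in> S2"
  shows "D (\<lambda>p. christoffel K p (T, 0) (0, v)) (x, y) (0, w) = 0"
proof -
  define c where "c x = D L x T / (2 * L x)" for x
  have "(\<lambda>x. inverse (L x)) differentiable_on S1"
    using L_pos by (intro differentiable_on_inverse L_diff) (metis less_irrefl)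
  then have "(\<lambda>x. D L x T * inverse (L x) * (1 / 2)) differentiable_on S1"
    by (intro differentiable_on_mult DL_diff differentiable_on_const)
  then have "c differentiable_on S1"
    by (rule differentiable_on_transform) (simp add: c_def field_simps)
  then have c': "(c has_derivative D c x) (at x)"
    by (rule differentiable_on_has_derivative[OF M.open_S _ x])
  then have "((\<lambda>p. c (fst p)) has_derivative (\<lambda>t. D c x (fst t))) (at (x, y))"
    using has_derivative_comp_fst[of c _ "(x, y)"] by simp
  note D_eq[OF has_derivative_Pair[OF has_derivative_const has_derivative_scaleR_left[OF this]], of "0 :: 'a" v]
  moreover have "D (\<lambda>p. christoffel K p (T, 0) (0, v)) (x, y) = D (\<lambda>p. (0, c (fst p) *\<^sub>R v)) (x, y)"
    using x y by (intro D_cong_open[OF open_S1_S2]) (auto simp: christoffel_K_horizontal c_def)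
  ultimately show ?thesis
    using linear_0[OF has_derivative_linear[OF c']] by (simp add: zero_prod_def)
qed

text \<open>The derivative terms have no N-component. Both remaining Christoffel terms have the
  N-component \<open>D L x T / (2 * L x)\<close> times \<open>christoffel h y e e\<close>, and they
  enter with opposite signs.\<close>

lemma snd_curvature_K:
  assumes x: "x \<in> S1" and y: "y \<in> S2"
  shows "snd (curvature K (x, y) (T, 0) (0, e) (0, e)) = 0"
proof -
  have nabla_const: "nabla K (\<lambda>_. v) (\<lambda>_. w) = (\<lambda>p. christoffel K p v w)" for v w
    by (simp add: nabla_def)
  have "curvature K (x, y) (T, 0) (0, e) (0, e) =
      D (\<lambda>p. christoffel K p (0, e) (0, e)) (x, y) (T, 0)
      + christoffel K (x, y) (T, 0) (- (h y e e / 2) *\<^sub>R grad_L x, christoffel h y e e)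
      - christoffel K (x, y) (0, e) (0, (D L x T / (2 * L x)) *\<^sub>R e)"
    unfolding curvature_def nabla_const
    unfolding nabla_def D_christoffel_horizontal[OF x y] christoffel_K_horizontal[OF x y]
      christoffel_K_vertical[OF x y, of e e] by simp
  then show ?thesis
    by (simp add: snd_D_christoffel_vertical[OF x y] snd_christoffel_K_horizontal[OF x y]
        christoffel_K_vertical[OF x y] N.christoffel_scaleR_right[OF y])
qed

section \<open>Tension and bitension of a slice\<close>

lemma second_fundamental_form_slice:
  assumes x: "x \<in> S1" and k: "metric_field S (k :: 'b local_metric)"
    and U: "open U" "U \<subseteq> S" "\<psi> ` U \<subseteq> S2" and \<psi>: "smooth_on U \<psi>"
    and iso: "\<And>y u v. y \<in> U \<Longrightarrow> k y u v = h (\<psi> y) (D \<psi> y u) (D \<psi> y v)"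
    and F: "\<And>y. y \<in> U \<Longrightarrow> F y = (x, \<psi> y)" and y: "y \<in> U"
  shows "second_fundamental_form k K F y u v = (- (k y u v / 2) *\<^sub>R grad_L x, 0)"
proof -
  have DF: "D F z v = (0, D \<psi> z v)" if "z \<in> U" for z v
    using differentiable_on_has_derivative[OF U(1) smooth_on_differentiable[OF \<psi>] that]
    by (subst D_cong_open[OF U(1) that F], simp, subst D_eq[OF has_derivative_Pair[OF has_derivative_const]]) simp_all
  have "D (\<lambda>z. D F z v) y u = D (\<lambda>z. (0, D \<psi> z v)) y u"
    by (subst D_cong_open[OF U(1) y DF]) simp_all
  also have "\<dots> = (0, D (\<lambda>z. D \<psi> z v) y u)"
    using differentiable_on_has_derivative[OF U(1) smooth_on_differentiable[OF smooth_on_D[OF \<psi>]] y]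
    by (subst D_eq[OF has_derivative_Pair[OF has_derivative_const]]) simp_all
  finally have D2F: "D (\<lambda>z. D F z v) y u = (0, D (\<lambda>z. D \<psi> z v) y u)" .
  have \<psi>y: "\<psi> y \<in> S2"
    using U y by auto
  \<comment> \<open>The N-component is the second fundamental form of the isometry
    \<open>\<psi>\<close>, which vanishes by \<open>christoffel_isometry\<close>. The M-component is
    the gradient term of \<open>christoffel_K\<close> on vertical vectors.\<close>
  show ?thesis
    unfolding second_fundamental_form_def pullback_nabla_def nabla_def D2F
    using christoffel_isometry[OF k N.metric_field_axioms U \<psi> iso y, of v u]
    by (simp add: F[OF y] DF[OF y] christoffel_K[OF x \<psi>y] M.christoffel_zero_left[OF x]
        linear_0[OF linear_DL[OF x]] iso[OF y])
qed

lemma tension_slice: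
  assumes x: "x \<in> S1" and k: "metric_field S (k :: 'b local_metric)"
    and U: "open U" "U \<subseteq> S" "\<psi> ` U \<subseteq> S2" and \<psi>: "smooth_on U \<psi>"
    and iso: "\<And>y u v. y \<in> U \<Longrightarrow> k y u v = h (\<psi> y) (D \<psi> y u) (D \<psi> y v)"
    and F: "\<And>y. y \<in> U \<Longrightarrow> F y = (x, \<psi> y)" and y: "y \<in> U"
  shows "tension k K F y = (- (DIM('b) / 2) *\<^sub>R grad_L x, 0)"
proof -
  interpret k: metric_field S k by (rule k)
  obtain E where "orthonormal_basis (k y) E"
    using k.ex_orthonormal_basis U y by blast
  then obtain E where E: "orthonormal_basis (k y) E"
    and tr: "\<And>T :: 'b \<Rightarrow> 'b \<Rightarrow> 'a \<times> 'b. metric_trace (k y) T = (\<Sum>e\<in>E. T e e)"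
    using metric_trace_orthonormal by metis
  have "tension k K F y = (\<Sum>e\<in>E. (- (k y e e / 2) *\<^sub>R grad_L x, 0))"
    unfolding tension_def tr
    by (intro sum.cong refl second_fundamental_form_slice[OF x k U \<psi> iso F y])
  also have "\<dots> = (\<Sum>e\<in>E. (- (1 / 2) *\<^sub>R grad_L x, 0))"
    using E by (intro sum.cong) (auto simp: orthonormal_basis_def)
  also have "\<dots> = (- (DIM('b) / 2) *\<^sub>R grad_L x, 0)"
    using E by (simp add: orthonormal_basis_def sum_constant_scaleR)
  finally show ?thesis .
qed

lemma snd_nabla2_slice:
  assumes x: "x \<in> S1" and f: "smooth_on S2 f"
    and F: "\<And>y. y \<in> S2 \<Longrightarrow> F y = (x, y)" and V: "\<And>y. y \<in> S2 \<Longrightarrow> V y = f y *\<^sub>R (T, 0)"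
    and y: "y \<in> S2"
  shows "snd (pullback_nabla K F (\<lambda>_. u) (pullback_nabla K F (\<lambda>_. v) V) y
      - pullback_nabla K F (nabla h (\<lambda>_. u) (\<lambda>_. v)) V y)
    = (D L x T / (2 * L x)) *\<^sub>R (D f y u *\<^sub>R v + D f y v *\<^sub>R u)"
proof -
  define c where "c = D L x T / (2 * L x)"
  have f': "(f has_derivative D f z) (at z)" if "z \<in> S2" for z
    using differentiable_on_has_derivative[OF N.open_S smooth_on_differentiable[OF f] that] .
  have f'': "((\<lambda>z. D f z v) has_derivative D (\<lambda>z. D f z v) y) (at y)" for v
    by (intro differentiable_on_has_derivative[OF N.open_S _ y] smooth_on_differentiable smooth_on_D f)
  have DF: "D F z v = (0, v)" if "z \<in> S2" for z v
    by (subst D_cong_open[OF N.open_S that F], simp,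
      subst D_eq[OF has_derivative_Pair[OF has_derivative_const has_derivative_ident]]) simp
  have DV: "D V z v = (D f z v *\<^sub>R T, 0)" if "z \<in> S2" for z v
    by (subst D_cong_open[OF N.open_S that V], simp,
      subst D_eq[OF has_derivative_scaleR_left[OF f'[OF that]]]) simp
  \<comment> \<open>The vertical part comes from the mixed Christoffel symbols, with
    \<open>c\<close> constant along the slice. The field \<open>X\<close> is arbitrary because it is
    later both a constant field and \<open>nabla h (\<lambda>_. u) (\<lambda>_. v)\<close>; in the
    latter case the vertical part cancels the term with \<open>christoffel h y u v\<close>.\<close>
  have pV: "pullback_nabla K F X V z = (D f z (X z) *\<^sub>R T, (f z * c) *\<^sub>R X z)" if "z \<in> S2" for X z
    by (simp add: pullback_nabla_def DF[OF that] DV[OF that] F[OF that] V[OF that] christoffel_K[OF x that]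
        M.christoffel_zero_left[OF x] N.christoffel_zero_right[OF that] linear_0[OF linear_DL[OF x]]
        linear_cmul[OF linear_DL[OF x]] bilinear_rzero[OF N.bil[OF that]] c_def)
  let ?W = "\<lambda>z. (D f z v *\<^sub>R T, (f z * c) *\<^sub>R v)"
  have "D (pullback_nabla K F (\<lambda>_. v) V) y u = D ?W y u"
    by (subst D_cong_open[OF N.open_S y pV]) simp_all
  also have "\<dots> = (D (\<lambda>z. D f z v) y u *\<^sub>R T, (D f y u * c) *\<^sub>R v)"
    by (subst D_eq[OF has_derivative_Pair[OF has_derivative_scaleR_left[OF f'']
      has_derivative_scaleR_left[OF has_derivative_mult_left[OF f'[OF y]]]]]) simp
  finally have "snd (pullback_nabla K F (\<lambda>_. u) (pullback_nabla K F (\<lambda>_. v) V) y)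
      = (D f y u * c) *\<^sub>R v + (f y * c) *\<^sub>R christoffel h y u v + (D f y v * c) *\<^sub>R u"
    unfolding pullback_nabla_def[of K F "\<lambda>_. u"] pV[OF y]
    by (simp add: DF[OF y] F[OF y] christoffel_K[OF x y] N.christoffel_scaleR_right[OF y]
        linear_0[OF linear_DL[OF x]] linear_cmul[OF linear_DL[OF x]] c_def)
  moreover have "nabla h (\<lambda>_. u) (\<lambda>_. v) y = christoffel h y u v"
    by (simp add: nabla_def)
  ultimately show ?thesis
    unfolding c_def[symmetric] snd_diff pV[OF y] by (simp add: algebra_simps)
qed

lemma f_bitension_slice_eq_0:
  assumes x: "x \<in> S1" and f: "smooth_on S2 f" and F: "\<And>y. y \<in> S2 \<Longrightarrow> F y = (x, y)"
    and y: "y \<in> S2" and 0: "f_bitension f h K F y = 0" and df: "D f y \<noteq> (\<lambda>_. 0)"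
  shows "grad_L x = 0"
proof -
  define T where "T = - (DIM('b) / 2) *\<^sub>R grad_L x"
  \<comment> \<open>Source chart and N-factor of the product chart agree here, so the isometry in
    \<open>tension_slice\<close> is the identity.\<close>
  have "smooth_on S2 (\<lambda>y. y)" by (rule smooth_on_ident)
  then have tension: "tension h K F z = (T, 0)" if "z \<in> S2" for z
    unfolding T_def using F that
    by (intro tension_slice[OF x N.metric_field_axioms N.open_S, of "\<lambda>y. y" F]) auto
  obtain E where "orthonormal_basis (h y) E"
    using N.ex_orthonormal_basis y by blast
  then obtain E where E: "orthonormal_basis (h y) E"
    and tr: "\<And>T :: 'b \<Rightarrow> 'b \<Rightarrow> 'a \<times> 'b. metric_trace (h y) T = (\<Sum>e\<in>E. T e e)"
    using metric_trace_orthonormal by metis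
  have DF: "D F y v = (0, v)" for v
    by (subst D_cong_open[OF N.open_S y F], simp,
      subst D_eq[OF has_derivative_Pair[OF has_derivative_const has_derivative_ident]]) simp
  define c where "c = D L x T / (2 * L x)"
  have "snd (trace_nabla2 h K F (\<lambda>y. f y *\<^sub>R tension h K F y) y)
      = (\<Sum>e\<in>E. c *\<^sub>R (D f y e *\<^sub>R e + D f y e *\<^sub>R e))"
    unfolding trace_nabla2_def tr snd_sum c_def
    by (intro sum.cong refl snd_nabla2_slice[OF x f F _ y]) (simp_all add: tension)
  moreover have "snd (metric_trace (h y) (\<lambda>u v. curvature K (F y) (tension h K F y) (D F y u) (D F y v))) = 0"
    unfolding tr snd_sum tension[OF y] F[OF y] DF by (simp add: snd_curvature_K[OF x y])
  ultimately have "snd (f_bitension f h K F y) = - (\<Sum>e\<in>E. c *\<^sub>R (D f y e *\<^sub>R e + D f y e *\<^sub>R e))"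
    unfolding f_bitension_def snd_diff snd_uminus snd_scaleR by simp
  also have "\<dots> = (\<Sum>e\<in>E. (- 2 * c * D f y e) *\<^sub>R e)"
    by (simp add: sum_negf[symmetric] scaleR_2[symmetric] ac_simps)
  finally have s: "(\<Sum>e\<in>E. (- 2 * c * D f y e) *\<^sub>R e) = 0"
    using 0 by simp
  have "linear (D f y)"
    using differentiable_on_has_derivative[OF N.open_S smooth_on_differentiable[OF f] y]
    by (rule has_derivative_linear)
  then have lin: "linear (\<lambda>e. - 2 * c * D f y e)"
    by (intro linearI) (simp_all add: linear_add[of "D f y"] linear_cmul[of "D f y"] algebra_simps)
  \<comment> \<open>The sum in \<open>s\<close> is the vector dual to the linear form
    \<open>- 2 * c * D f y\<close>; it is zero, so the form is zero.\<close>
  have "- 2 * c * D f y w = 0" for w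
    using N.metric_frame_sum[OF y lin E, of w] unfolding s by (simp add: bilinear_lzero[OF N.bil[OF y]])
  then have "c = 0"
    using df by fastforce
  \<comment> \<open>\<open>D L x T\<close> is \<open>- DIM('b) / 2\<close> times the squared length
    of the gradient, and \<open>DIM('b)\<close> is positive.\<close>
  then have "g x (grad_L x) (grad_L x) = 0"
    using L_pos[OF x] grad_L_works[OF x, of "grad_L x"] by (simp add: c_def T_def linear_cmul[OF linear_DL[OF x]] linear_neg[OF linear_DL[OF x]])
  then show ?thesis
    using M.pos[OF x] by fastforce
qed

end

section \<open>Charts\<close>

lemma
  assumes "smooth_atlas A"
  shows atlas_open: "open (fst (A i))"
    and atlas_open_image: "open (chart_image (A i))"
    and atlas_homeomorphism:
      "homeomorphism (fst (A i)) (chart_image (A i)) (snd (A i)) (chart_inv (A i))"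
  using assms unfolding smooth_atlas_def by blast+

lemma atlas_cover: "smooth_atlas A \<Longrightarrow> \<exists>i. p \<in> fst (A i)"
  unfolding smooth_atlas_def by blast

lemma chart_inv_chart: "smooth_atlas A \<Longrightarrow> p \<in> fst (A i) \<Longrightarrow> chart_inv (A i) (snd (A i) p) = p"
  by (rule homeomorphism_apply1[OF atlas_homeomorphism])

lemma chart_chart_inv: "smooth_atlas A \<Longrightarrow> x \<in> chart_image (A i) \<Longrightarrow> snd (A i) (chart_inv (A i) x) = x"
  by (rule homeomorphism_apply2[OF atlas_homeomorphism])

lemma chart_in_image: "p \<in> fst c \<Longrightarrow> snd c p \<in> chart_image c"
  by (simp add: chart_image_def)

lemma chart_inv_in: "smooth_atlas A \<Longrightarrow> x \<in> chart_image (A i) \<Longrightarrow> chart_inv (A i) x \<in> fst (A i)"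
  using homeomorphism_image2[OF atlas_homeomorphism, of A i] by blast

text \<open>The image under the chart is a preimage under its continuous inverse.\<close>

lemma transition_domain_open:
  assumes "smooth_atlas A"
  shows "open (snd (A i) ` (fst (A i) \<inter> fst (A j)))"
proof -
  have "snd (A i) ` (fst (A i) \<inter> fst (A j)) = chart_image (A i) \<inter> chart_inv (A i) -` fst (A j)"
  proof (intro equalityI subsetI)
    fix x assume "x \<in> snd (A i) ` (fst (A i) \<inter> fst (A j))"
    then obtain p where "p \<in> fst (A i)" "p \<in> fst (A j)" "x = snd (A i) p"
      by blast
    then show "x \<in> chart_image (A i) \<inter> chart_inv (A i) -` fst (A j)"
      using chart_inv_chart[OF assms, of p i] by (simp add: chart_in_image)
  next
    fix x assume "x \<in> chart_image (A i) \<inter> chart_inv (A i) -` fst (A j)"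
    then have "chart_inv (A i) x \<in> fst (A i) \<inter> fst (A j)" "x = snd (A i) (chart_inv (A i) x)"
      using chart_inv_in[OF assms] chart_chart_inv[OF assms] by auto
    then show "x \<in> snd (A i) ` (fst (A i) \<inter> fst (A j))"
      by (rule image_eqI[rotated])
  qed
  then show ?thesis
    using continuous_open_preimage[OF homeomorphism_cont2[OF atlas_homeomorphism[OF assms]]
      atlas_open_image[OF assms] atlas_open[OF assms]] by simp
qed

lemma riemannian_metric_field:
  assumes "smooth_atlas A" "riemannian_metric A g"
  shows "metric_field (chart_image (A i)) (g i)"
proof
  show "open (chart_image (A i))"
    by (rule atlas_open_image[OF assms(1)])
  show "inner_form (g i x)" if "x \<in> chart_image (A i)" for x
    using assms(2) that unfolding riemannian_metric_def inner_form_def by blast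
  show "smooth_on (chart_image (A i)) (\<lambda>x. g i x u v)" for u v
    using assms(2) unfolding riemannian_metric_def by blast
qed

text \<open>A vanishing differential makes \<open>f\<close> constant on chart balls, which are
  convex, hence locally constant; connectedness does the rest. Its contrapositive provides a point
  with non-zero differential.\<close>

lemma smooth_fun_constant:
  fixes B :: "'j \<Rightarrow> ('n::{t2_space,second_countable_topology}, 'b::euclidean_space) chart"
  assumes B: "smooth_atlas B" and f: "smooth_fun B f" and conn: "connected (UNIV :: 'n set)"
    and D0: "\<And>j y. y \<in> chart_image (B j) \<Longrightarrow> D (f \<circ> chart_inv (B j)) y = (\<lambda>_. 0)"
  shows "f constant_on UNIV"
proof -
  have "\<forall>\<^sub>F q in at p. f p = f q" for p
  proof -
    obtain j where p: "p \<in> fst (B j)"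
      using atlas_cover[OF B] by blast
    let ?F = "f \<circ> chart_inv (B j)"
    have y: "snd (B j) p \<in> chart_image (B j)"
      by (rule chart_in_image[OF p])
    then obtain r where r: "r > 0" "ball (snd (B j) p) r \<subseteq> chart_image (B j)"
      using atlas_open_image[OF B, of j] unfolding open_contains_ball by blast
    have diff: "?F differentiable_on chart_image (B j)"
      using f smooth_on_differentiable unfolding smooth_fun_def by blast
    have "(?F has_derivative (\<lambda>_. 0)) (at z within ball (snd (B j) p) r)"
      if "z \<in> ball (snd (B j) p) r" for z
    proof -
      have "z \<in> chart_image (B j)"
        using that r(2) by blast
      from differentiable_on_has_derivative[OF atlas_open_image[OF B] diff this] D0[OF this]
      show ?thesis
        by (simp add: has_derivative_at_withinI)
    qed
    then obtain c where c: "\<And>z. z \<in> ball (snd (B j) p) r \<Longrightarrow> ?F z = c"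
      using has_derivative_zero_constant[OF convex_ball, of "snd (B j) p" r ?F] by blast
    let ?W = "fst (B j) \<inter> snd (B j) -` ball (snd (B j) p) r"
    have "open ?W"
      by (rule continuous_open_preimage[OF homeomorphism_cont1[OF atlas_homeomorphism[OF B]]
          atlas_open[OF B] open_ball])
    moreover have "p \<in> ?W"
      using p r(1) by simp
    moreover have "f p = f q" if "q \<in> ?W" for q
      using c[of "snd (B j) p"] c[of "snd (B j) q"] that r(1)
        chart_inv_chart[OF B p] chart_inv_chart[OF B, of q j] by simp
    ultimately show ?thesis
      unfolding eventually_at_topological by blast
  qed
  then show ?thesis
    unfolding constant_on_def using connected_local_const[OF conn UNIV_I UNIV_I, of f] by blast
qed

lemma warped_metric_eq_warp:
  "warped_metric A g lam h (i, j) = warp (g i) (\<lambda>x. (lam (chart_inv (A i) x))\<^sup>2) (h j)"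
  by (auto simp: warped_metric_def warp_def fun_eq_iff)

text \<open>The locale asks for two derivatives of the squared warping function; the second is read
  off from the explicit first derivative \<open>2 * m x * D m x v\<close>.\<close>

lemma warped_chart_warped_metric:
  assumes "smooth_atlas A" "riemannian_metric A g" "smooth_atlas B" "riemannian_metric B h"
    and lam: "smooth_fun A lam" and lam_pos: "\<And>x. 0 < lam x"
  shows "warped_chart (chart_image (A i)) (g i) (chart_image (B j)) (h j)
    (\<lambda>x. (lam (chart_inv (A i) x))\<^sup>2)"
proof -
  let ?S = "chart_image (A i)"
  define m where "m = (\<lambda>x. lam (chart_inv (A i) x))"
  have m: "smooth_on ?S m"
    using lam unfolding smooth_fun_def m_def comp_def by blast
  note m' = smooth_on_differentiable[OF m] smooth_on_differentiable[OF smooth_on_D[OF m]]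
  have Dm2: "D (\<lambda>x. (m x)\<^sup>2) x v = 2 * m x * D m x v" if "x \<in> ?S" for x v
  proof -
    have md: "(m has_derivative D m x) (at x)"
      by (rule differentiable_on_has_derivative[OF atlas_open_image[OF assms(1)] m'(1) that])
    show ?thesis
      unfolding power2_eq_square D_eq[OF has_derivative_mult[OF md md]] by simp
  qed
  have "(\<lambda>x. 2 * m x * D m x v) differentiable_on ?S" for v
    by (intro differentiable_on_mult differentiable_on_const m')
  then have "(\<lambda>x. D (\<lambda>x. (m x)\<^sup>2) x v) differentiable_on ?S" for v
    using Dm2 by (rule differentiable_on_transform)
  moreover have "(\<lambda>x. (m x)\<^sup>2) differentiable_on ?S"
    unfolding power2_eq_square by (intro differentiable_on_mult m')
  moreover have "0 < (m x)\<^sup>2" for x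
    unfolding m_def by (intro zero_less_power lam_pos)
  ultimately show ?thesis
    unfolding warped_chart_def warped_chart_axioms_def m_def
    using riemannian_metric_field[OF assms(1,2)] riemannian_metric_field[OF assms(3,4)] by blast
qed

theorem corollary6p3:
  fixes A :: "'i \<Rightarrow> ('m::{t2_space,second_countable_topology}, 'a::euclidean_space) chart"
    and g :: "'i \<Rightarrow> 'a local_metric"
    and B :: "'j \<Rightarrow> ('n::{t2_space,second_countable_topology}, 'b::euclidean_space) chart"
    and h :: "'j \<Rightarrow> 'b local_metric"
    and lam :: "'m \<Rightarrow> real" and f :: "'n \<Rightarrow> real" and x0 :: 'm
  assumes "smooth_atlas A" and "riemannian_metric A g"
    and "smooth_atlas B" and "riemannian_metric B h"
    and "connected (UNIV :: 'n set)"
    and "smooth_fun A lam" and "\<And>x. 0 < lam x"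
    and "smooth_fun B f" and "\<And>y. 0 < f y"
  shows "\<not> nontrivial_f_biharmonic_map f B h (prod_atlas A B) (warped_metric A g lam h)
           (\<lambda>y. (x0, y))"
proof
  let ?\<phi> = "\<lambda>y. (x0, y)"
  assume nt: "nontrivial_f_biharmonic_map f B h (prod_atlas A B) (warped_metric A g lam h) ?\<phi>"
  note A = assms(1) and B = assms(3)
  define L where "L i x = (lam (chart_inv (A i) x))\<^sup>2" for i x
  have wc: "warped_chart (chart_image (A i)) (g i) (chart_image (B j)) (h j) (L i)" for i j
    unfolding L_def by (rule warped_chart_warped_metric[OF assms(1-4,6,7)])
  have K: "warped_metric A g lam h (i, j) = warp (g i) (L i) (h j)" for i j
    by (simp add: warped_metric_eq_warp L_def[abs_def])
  have "\<not> f constant_on UNIV"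
    using nt by (simp add: nontrivial_f_biharmonic_map_def)
  then obtain j y where y: "y \<in> chart_image (B j)" and df: "D (f \<circ> chart_inv (B j)) y \<noteq> (\<lambda>_. 0)"
    using smooth_fun_constant[OF B assms(8,5)] by blast
  \<comment> \<open>The same \<open>j\<close> and \<open>y\<close> serve every chart of M around
    \<open>x0\<close>, since the inclusion is represented on all of
    \<open>chart_image (B j)\<close>. So the gradient vanishes in each such chart directly, without
    being transformed between charts.\<close>
  have Z0: "warped_chart.grad_L (g i) (L i) (snd (A i) x0) = 0" if x0: "x0 \<in> fst (A i)" for i
  proof -
    interpret warped_chart "chart_image (A i)" "g i" "chart_image (B j)" "h j" "L i"
      by (rule wc)
    have dom: "local_dom (B j) (prod_atlas A B (i, j)) ?\<phi> = chart_image (B j)"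
      using x0 by (auto simp: local_dom_def prod_atlas_def chart_image_def)
    show ?thesis
    proof (rule f_bitension_slice_eq_0[OF chart_in_image[OF x0] _ _ y _ df])
      show "smooth_on (chart_image (B j)) (f \<circ> chart_inv (B j))"
        using assms(8) by (simp add: smooth_fun_def)
      show "local_rep (B j) (prod_atlas A B (i, j)) ?\<phi> y = (snd (A i) x0, y)"
        if "y \<in> chart_image (B j)" for y
        using chart_chart_inv[OF B that] by (simp add: local_rep_def prod_atlas_def)
      show "f_bitension (f \<circ> chart_inv (B j)) (h j) K (local_rep (B j) (prod_atlas A B (i, j)) ?\<phi>) y = 0"
        using nt y dom unfolding nontrivial_f_biharmonic_map_def f_biharmonic_map_def K[symmetric] by blast
    qed
  qed
  have "tension (h j) (warped_metric A g lam h c) (local_rep (B j) (prod_atlas A B c) ?\<phi>) z = 0"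
    if z: "z \<in> local_dom (B j) (prod_atlas A B c) ?\<phi>" for j c z
  proof -
    obtain i k where c: "c = (i, k)"
      by (cases c)
    interpret warped_chart "chart_image (A i)" "g i" "chart_image (B k)" "h k" "L i"
      by (rule wc)
    \<comment> \<open>The N-factor \<open>B k\<close> of the product chart may differ from the
      source chart \<open>B j\<close>; the inclusion then reads
      \<open>(snd (A i) x0, ?\<psi> y)\<close>, and the transformation law of \<open>h\<close> makes
      \<open>?\<psi>\<close> an isometry.\<close>
    let ?U = "snd (B j) ` (fst (B j) \<inter> fst (B k))"
    let ?\<psi> = "snd (B k) \<circ> chart_inv (B j)"
    obtain p where "p \<in> fst (B j)" "x0 \<in> fst (A i)" "p \<in> fst (B k)" "z = snd (B j) p"
      using z unfolding local_dom_def prod_atlas_def c vimage_def by auto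
    then have x0: "x0 \<in> fst (A i)" and zU: "z \<in> ?U"
      by blast+
    have "tension (h j) K (local_rep (B j) (prod_atlas A B c) ?\<phi>) z
        = (- (DIM('b) / 2) *\<^sub>R grad_L (snd (A i) x0), 0)"
    proof (rule tension_slice[OF chart_in_image[OF x0] riemannian_metric_field[OF assms(3,4)]
          transition_domain_open[OF B] _ _ _ _ _ zU])
      show "?U \<subseteq> chart_image (B j)"
        by (auto simp: chart_image_def)
      show "?\<psi> ` ?U \<subseteq> chart_image (B k)"
      proof
        fix w assume "w \<in> ?\<psi> ` ?U"
        then obtain p where "p \<in> fst (B j)" "p \<in> fst (B k)" "w = snd (B k) (chart_inv (B j) (snd (B j) p))"
          by auto
        then show "w \<in> chart_image (B k)"
          by (simp add: chart_inv_chart[OF B] chart_in_image)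
      qed
      show "smooth_on ?U ?\<psi>"
        using B unfolding smooth_atlas_def by blast
      show "local_rep (B j) (prod_atlas A B c) ?\<phi> y = (snd (A i) x0, ?\<psi> y)" for y
        by (simp add: local_rep_def prod_atlas_def c)
      show "h j y u v = h k (?\<psi> y) (D ?\<psi> y u) (D ?\<psi> y v)" if y: "y \<in> ?U" for y u v
      proof -
        obtain p where p: "p \<in> fst (B j) \<inter> fst (B k)" "y = snd (B j) p"
          using y by blast
        then have "h j (snd (B j) p) u v = h k (snd (B k) p) (D ?\<psi> (snd (B j) p) u) (D ?\<psi> (snd (B j) p) v)"
          using assms(4) unfolding riemannian_metric_def Let_def by blast
        then show ?thesis
          using p chart_inv_chart[OF B, of p j] by simp
      qed
    qed
    then show ?thesis
      unfolding c K using Z0[OF x0] by (simp add: zero_prod_def)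
  qed
  \<comment> \<open>Smoothness of the inclusion, a part of \<open>harmonic_map\<close>, is taken
    from the assumed \<open>f\<close>-bi-harmonicity.\<close>
  then have "harmonic_map B h (prod_atlas A B) (warped_metric A g lam h) ?\<phi>"
    using nt unfolding nontrivial_f_biharmonic_map_def f_biharmonic_map_def harmonic_map_def by blast
  then show False
    using nt by (simp add: nontrivial_f_biharmonic_map_def)
qed

end
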